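(* Let $X_1, X_2, \ldots$ be iid real random variables with density $f$, such that $P(X_1>0)>0$. Suppose $f$ satisfies the following conditions. 1) $f$ is bounded and continuous on $\mathbb{R}$ and there is $\gamma>0$ such that $\limsup_{x\to\infty} x^{1+\gamma} f(x)<\infty$. 2) The function $z\mapsto z f(z)$ has a unique maximizer $z_0$, and $z_0>0$. 3) $h := \log f$ is three times differentiable on $\mathbb{R}$, with $\sup_{x\in\mathbb{R}} |h''(x)|<\infty$ and $\sup_{x\in\mathbb{R}} |h'''(x)|<\infty$. Let $a_n\to\infty$ be such that $a_n^4 = o(n/\log n)$. Then for any sequence $d_n\to d$ with $d \in (0,\infty)$, $$\frac{P\left(\bar X + d_n/n \ge a_n V\right)}{P\left(\bar X \ge a_n V\right)} \to e^{d/z_0}, \qquad \text{as } n\to\infty .$$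
   Context: For each $n$, $\bar X$ and $V$ denote the sample mean and the (biased) sample standard deviation of $X_1,\ldots,X_n$: $$\bar X = \frac{1}{n}\sum_{i=1}^n X_i, \qquad V = \left[\frac{1}{n}\sum_{i=1}^n (X_i-\bar X)^2\right]^{1/2}.$$ Both depend on $n$; for different $n$ they are different random variables. *)

theory Defs
  imports "HOL-Probability.Probability"
begin

definition sample_mean :: "(nat \<Rightarrow> 'a \<Rightarrow> real) \<Rightarrow> nat \<Rightarrow> 'a \<Rightarrow> real" where
  "sample_mean X n \<omega> = (1 / real n) * (\<Sum>i=1..n. X i \<omega>)"

text \<open>The biased standard deviation: the normalisation is by \<open>n\<close>, not \<open>n - 1\<close>.\<close>

definition sample_sd :: "(nat \<Rightarrow> 'a \<Rightarrow> real) \<Rightarrow> nat \<Rightarrow> 'a \<Rightarrow> real" where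
  "sample_sd X n \<omega> =
     sqrt ((1 / real n) * (\<Sum>i=1..n. (X i \<omega> - sample_mean X n \<omega>)\<^sup>2))"

end

theory Submission
  imports Defs
begin

text \<open>
Both events concern the vector of observations, whose density is a product. The event in the
denominator is that this vector lies in the cone of all \<open>x\<close> with \<open>mean x \<ge> a * sd x\<close>; the event in
the numerator is that its translate by \<open>\<delta> = d\<^sub>n / n\<close> does. So both probabilities are integrals over
the same cone, of \<open>\<Prod>i. f (x i)\<close> and of \<open>\<Prod>i. f (x i - \<delta>)\<close>, and their quotient is the average
of the likelihood ratio with respect to the law of the observations conditioned on the cone.

Under this conditional law the mean concentrates at \<open>z\<^sub>0\<close>. As \<open>a \<rightarrow> \<infinity>\<close> the cone
closes up around the diagonal: at mean \<open>z\<close> the standard deviation is at most \<open>z / a\<close>. Since \<open>ln f\<close>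
has bounded second derivative and deviations from the mean sum to zero, the joint density there is
\<open>f z ^ n\<close> up to a factor \<open>exp (n * O((z / a)\<^sup>2))\<close> (\<open>prod_density_on_cone\<close>). The volume of the part
of the cone with mean at most \<open>t\<close> is proportional to \<open>t ^ n\<close>, because the cone is invariant under
dilations (\<open>emeasure_cone_below\<close>). Hence the mass at mean \<open>z\<close> is \<open>(z * f z) ^ n\<close> up to
subexponential factors and a constant that cancels, and the unique maximizer of \<open>z * f z\<close> wins
exponentially (\<open>far_mass_le\<close>, \<open>near_mass_ge\<close>). The estimate of the density fails where \<open>z\<close> is
comparable to \<open>a\<close>; large means are excluded with the tail bound on \<open>f\<close> instead, because most
coordinates of a vector in the cone exceed half of its mean (\<open>emeasure_tail\<close>).

Where the mean is near \<open>z\<^sub>0\<close>, the log likelihood ratio is \<open>- \<delta> * (\<Sum>i. h' (x i))\<close> to first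
order with \<open>h = ln f\<close>, hence close to \<open>- d * h' z\<^sub>0\<close> (\<open>near_likelihood_ratio\<close>). As \<open>z\<^sub>0\<close> is a critical
point of \<open>ln z + h z\<close>, this is \<open>d / z\<^sub>0\<close>.
\<close>

section \<open>The cone of vectors with large mean relative to their deviation\<close>

abbreviation Leb :: "nat \<Rightarrow> (nat \<Rightarrow> real) measure" where
  "Leb n \<equiv> Pi\<^sub>M {1..n} (\<lambda>_. lborel)"

abbreviation mean :: "nat \<Rightarrow> (nat \<Rightarrow> real) \<Rightarrow> real" where
  "mean \<equiv> sample_mean (\<lambda>i x. x i)"

abbreviation sd :: "nat \<Rightarrow> (nat \<Rightarrow> real) \<Rightarrow> real" where
  "sd \<equiv> sample_sd (\<lambda>i x. x i)"

definition mean_sd_cone :: "nat \<Rightarrow> real \<Rightarrow> (nat \<Rightarrow> real) set" where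
  "mean_sd_cone n a = {x \<in> space (Leb n). a * sd n x \<le> mean n x}"

text \<open>
The measure with density \<open>\<Prod>i. g (x i)\<close>, which makes sense for every \<open>g\<close>. When \<open>g\<close> is a
probability density it is the law of \<open>n\<close> independent draws from \<open>g\<close> (\<open>iid_eq_PiM\<close>). A density
with respect to Lebesgue measure is the convenient form here: all estimates are pointwise
bounds on the density, followed by a volume computation.
\<close>

definition iid :: "(real \<Rightarrow> real) \<Rightarrow> nat \<Rightarrow> (nat \<Rightarrow> real) measure" where
  "iid g n = density (Leb n) (\<lambda>x. \<Prod>i=1..n. ennreal (g (x i)))"

text \<open>
The volume of the part of the cone below height 1. It depends on \<open>n\<close> and \<open>a\<close> in a complicated way
but is never computed, because it is a common factor of all masses that are compared.
\<close>

definition cone_volume :: "nat \<Rightarrow> real \<Rightarrow> real" where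
  "cone_volume n a = measure (Leb n) {x \<in> mean_sd_cone n a. mean n x \<le> 1}"

lemma component_measurable:
  "i \<in> I \<Longrightarrow> (\<lambda>x. x i) \<in> borel_measurable (Pi\<^sub>M I (\<lambda>_. lborel :: real measure))"
  using measurable_component_singleton[of i I "\<lambda>_. lborel :: real measure"] by simp

lemma mean_measurable: "mean n \<in> borel_measurable (Leb n)"
  unfolding sample_mean_def[abs_def]
  by (intro borel_measurable_times borel_measurable_const borel_measurable_sum component_measurable)

lemma sd_measurable: "sd n \<in> borel_measurable (Leb n)"
  unfolding sample_sd_def[abs_def]
  by (intro measurable_compose[OF _ borel_measurable_sqrt] borel_measurable_times
      borel_measurable_const borel_measurable_sum borel_measurable_power borel_measurable_diff
      component_measurable mean_measurable)

lemma cone_sets: "mean_sd_cone n a \<in> sets (Leb n)"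
  unfolding mean_sd_cone_def
  by (intro borel_measurable_le borel_measurable_times borel_measurable_const
      mean_measurable sd_measurable)

lemma cone_slab_sets:
  assumes "S \<in> sets borel"
  shows "{x \<in> mean_sd_cone n a. mean n x \<in> S} \<in> sets (Leb n)"
proof -
  have "{x \<in> mean_sd_cone n a. mean n x \<in> S} = mean_sd_cone n a \<inter> (mean n -` S \<inter> space (Leb n))"
    by (auto simp: mean_sd_cone_def)
  also have "\<dots> \<in> sets (Leb n)"
    by (rule sets.Int[OF cone_sets measurable_sets[OF mean_measurable assms]])
  finally show ?thesis .
qed

lemma cone_below_sets: "{x \<in> mean_sd_cone n a. mean n x \<le> t} \<in> sets (Leb n)"
  using cone_slab_sets[of "{..t}" n a] by simp

lemma joint_measurable:
  assumes [measurable]: "g \<in> borel_measurable borel"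
  shows "(\<lambda>x. \<Prod>i=1..n. ennreal (g (x i))) \<in> borel_measurable (Leb n)"
  by (intro borel_measurable_prod_ennreal measurable_compose[OF component_measurable]) measurable

lemma sets_iid [simp, measurable_cong]: "sets (iid g n) = sets (Leb n)"
  by (simp add: iid_def)

lemma space_iid [simp]: "space (iid g n) = space (Leb n)"
  by (simp add: iid_def)

section \<open>The joint law of independent observations\<close>

lemma iid_eq_PiM:
  assumes g [measurable]: "g \<in> borel_measurable borel"
    and prob: "prob_space (density lborel (\<lambda>x. ennreal (g x)))"
  shows "iid g n = Pi\<^sub>M {1..n} (\<lambda>_. density lborel (\<lambda>x. ennreal (g x)))"
proof -
  interpret G: product_sigma_finite "\<lambda>_::nat. density lborel (\<lambda>x. ennreal (g x))"
    using prob by (simp add: product_sigma_finite_def prob_space_imp_sigma_finite)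
  interpret L: product_sigma_finite "\<lambda>_::nat. lborel :: real measure" ..
  show ?thesis
  proof (rule G.PiM_eqI)
    show "sets (iid g n) = sets (Pi\<^sub>M {1..n} (\<lambda>_. density lborel (\<lambda>x. ennreal (g x))))"
      unfolding sets_iid by (rule sets_PiM_cong) auto
    fix A :: "nat \<Rightarrow> real set"
    assume A: "\<And>i. i \<in> {1..n} \<Longrightarrow> A i \<in> sets (density lborel (\<lambda>x. ennreal (g x)))"
    have box: "Pi\<^sub>E {1..n} A \<in> sets (Leb n)"
      using A by (intro sets_PiM_I_finite) auto
    have "emeasure (iid g n) (Pi\<^sub>E {1..n} A)
      = (\<integral>\<^sup>+x. (\<Prod>i=1..n. ennreal (g (x i))) * indicator (Pi\<^sub>E {1..n} A) x \<partial>Leb n)"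
      unfolding iid_def by (rule emeasure_density[OF joint_measurable[OF g] box])
    also have "\<dots> = (\<integral>\<^sup>+x. (\<Prod>i=1..n. ennreal (g (x i)) * indicator (A i) (x i)) \<partial>Leb n)"
    proof (rule nn_integral_cong)
      fix x assume "x \<in> space (Leb n)"
      then have "indicator (Pi\<^sub>E {1..n} A) x = (\<Prod>i=1..n. indicator (A i) (x i) :: ennreal)"
        by (auto simp: indicator_def space_PiM PiE_def Pi_def prod_zero_iff intro!: prod.neutral)
      then show "(\<Prod>i=1..n. ennreal (g (x i))) * indicator (Pi\<^sub>E {1..n} A) x
        = (\<Prod>i=1..n. ennreal (g (x i)) * indicator (A i) (x i))"
        by (simp add: prod.distrib)
    qed
    also have "\<dots> = (\<Prod>i=1..n. \<integral>\<^sup>+y. ennreal (g y) * indicator (A i) y \<partial>lborel)"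
      using A by (intro L.product_nn_integral_prod) auto
    also have "\<dots> = (\<Prod>i=1..n. emeasure (density lborel (\<lambda>x. ennreal (g x))) (A i))"
      using A by (intro prod.cong refl) (simp add: emeasure_density)
    finally show "emeasure (iid g n) (Pi\<^sub>E {1..n} A)
      = (\<Prod>i=1..n. emeasure (density lborel (\<lambda>x. ennreal (g x))) (A i))" .
  qed simp
qed

lemma prob_space_iid:
  assumes "g \<in> borel_measurable borel" "prob_space (density lborel (\<lambda>x. ennreal (g x)))"
  shows "prob_space (iid g n)"
  unfolding iid_eq_PiM[OF assms] using assms(2) by (intro prob_space_PiM)

text \<open>
Here and in the next two lemmas, a pointwise bound on the joint density becomes a bound on masses.
\<close>

lemma emeasure_iid_le:
  assumes g [measurable]: "g \<in> borel_measurable borel" "\<And>x. g x \<ge> 0"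
    and A: "A \<in> sets (Leb n)" and le: "\<And>x. x \<in> A \<Longrightarrow> (\<Prod>i=1..n. g (x i)) \<le> c"
  shows "emeasure (iid g n) A \<le> ennreal c * emeasure (Leb n) A"
proof -
  have "emeasure (iid g n) A = (\<integral>\<^sup>+x. (\<Prod>i=1..n. ennreal (g (x i))) * indicator A x \<partial>Leb n)"
    unfolding iid_def by (rule emeasure_density[OF joint_measurable[OF g(1)] A])
  also have "\<dots> \<le> (\<integral>\<^sup>+x. ennreal c * indicator A x \<partial>Leb n)"
    using le g(2) by (intro nn_integral_mono) (auto simp: indicator_def prod_ennreal ennreal_leI)
  also have "\<dots> = ennreal c * emeasure (Leb n) A"
    using A by (rule nn_integral_cmult_indicator)
  finally show ?thesis .
qed

lemma emeasure_iid_ge: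
  assumes g [measurable]: "g \<in> borel_measurable borel" "\<And>x. g x \<ge> 0"
    and A: "A \<in> sets (Leb n)" and ge: "\<And>x. x \<in> A \<Longrightarrow> c \<le> (\<Prod>i=1..n. g (x i))"
  shows "ennreal c * emeasure (Leb n) A \<le> emeasure (iid g n) A"
proof -
  have "ennreal c * emeasure (Leb n) A = (\<integral>\<^sup>+x. ennreal c * indicator A x \<partial>Leb n)"
    using A by (rule nn_integral_cmult_indicator[symmetric])
  also have "\<dots> \<le> (\<integral>\<^sup>+x. (\<Prod>i=1..n. ennreal (g (x i))) * indicator A x \<partial>Leb n)"
    using ge g(2) by (intro nn_integral_mono) (auto simp: indicator_def prod_ennreal ennreal_leI)
  also have "\<dots> = emeasure (iid g n) A"
    unfolding iid_def by (rule emeasure_density[OF joint_measurable[OF g(1)] A, symmetric])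
  finally show ?thesis .
qed

lemma emeasure_iid_mono:
  assumes g [measurable]: "g \<in> borel_measurable borel" "\<And>x. g x \<ge> 0"
    and g' [measurable]: "g' \<in> borel_measurable borel" "\<And>x. g' x \<ge> 0" and "c \<ge> 0"
    and A: "A \<in> sets (Leb n)"
    and le: "\<And>x. x \<in> A \<Longrightarrow> (\<Prod>i=1..n. g (x i)) \<le> c * (\<Prod>i=1..n. g' (x i))"
  shows "emeasure (iid g n) A \<le> ennreal c * emeasure (iid g' n) A"
proof -
  have "emeasure (iid g n) A = (\<integral>\<^sup>+x. (\<Prod>i=1..n. ennreal (g (x i))) * indicator A x \<partial>Leb n)"
    unfolding iid_def by (rule emeasure_density[OF joint_measurable[OF g(1)] A])
  also have "\<dots> \<le> (\<integral>\<^sup>+x. ennreal c * ((\<Prod>i=1..n. ennreal (g' (x i))) * indicator A x) \<partial>Leb n)"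
    using le g(2) g'(2) \<open>c \<ge> 0\<close>
    by (intro nn_integral_mono)
      (auto simp: indicator_def prod_ennreal ennreal_leI prod_nonneg simp flip: ennreal_mult)
  also have "\<dots> = ennreal c * (\<integral>\<^sup>+x. (\<Prod>i=1..n. ennreal (g' (x i))) * indicator A x \<partial>Leb n)"
    using A joint_measurable[OF g'(1)] by (intro nn_integral_cmult) auto
  also have "(\<integral>\<^sup>+x. (\<Prod>i=1..n. ennreal (g' (x i))) * indicator A x \<partial>Leb n) = emeasure (iid g' n) A"
    unfolding iid_def by (rule emeasure_density[OF joint_measurable[OF g'(1)] A, symmetric])
  finally show ?thesis .
qed

lemma (in prob_space) joint_law:
  assumes ind: "indep_vars (\<lambda>_. borel) X {1..}"
    and dist: "\<And>i. i \<ge> 1 \<Longrightarrow> distributed M lborel (X i) (\<lambda>x. ennreal (g x))"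
    and g [measurable]: "g \<in> borel_measurable borel"
    and n: "n \<ge> 1"
  shows "distr M (Leb n) (\<lambda>\<omega>. \<lambda>i\<in>{1..n}. X i \<omega>) = iid g n"
proof -
  have rv: "random_variable borel (X i)" if "i \<ge> 1" for i
    using distributed_measurable[OF dist[OF that]] by simp
  have law: "distr M borel (X i) = density lborel (\<lambda>x. ennreal (g x))" if "i \<ge> 1" for i
  proof -
    have "distr M borel (X i) = distr M lborel (X i)"
      by (rule distr_cong) auto
    then show ?thesis
      using distributed_distr_eq_density[OF dist[OF that]] by simp
  qed
  have prob: "prob_space (density lborel (\<lambda>x. ennreal (g x)))"
    using prob_space_distr[OF rv[of 1]] law[of 1] by simp
  have "indep_vars (\<lambda>_. borel) X {1..n}"
    by (rule indep_vars_subset[OF ind]) auto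
  then have "distr M (\<Pi>\<^sub>M i\<in>{1..n}. borel) (\<lambda>\<omega>. \<lambda>i\<in>{1..n}. X i \<omega>)
    = (\<Pi>\<^sub>M i\<in>{1..n}. distr M borel (X i))"
    using n rv by (subst (asm) indep_vars_iff_distr_eq_PiM') auto
  also have "\<dots> = Pi\<^sub>M {1..n} (\<lambda>_. density lborel (\<lambda>x. ennreal (g x)))"
    using law by (intro PiM_cong) auto
  also have "\<dots> = iid g n"
    by (rule iid_eq_PiM[OF g prob, symmetric])
  also have "distr M (\<Pi>\<^sub>M i\<in>{1..n}. borel) (\<lambda>\<omega>. \<lambda>i\<in>{1..n}. X i \<omega>)
    = distr M (Leb n) (\<lambda>\<omega>. \<lambda>i\<in>{1..n}. X i \<omega>)"
    by (rule distr_cong) (auto intro!: sets_PiM_cong)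
  finally show ?thesis .
qed

lemma mean_restrict [simp]: "mean n (\<lambda>i\<in>{1..n}. X i \<omega>) = sample_mean X n \<omega>"
  by (simp add: sample_mean_def)

lemma sd_restrict [simp]: "sd n (\<lambda>i\<in>{1..n}. X i \<omega>) = sample_sd X n \<omega>"
  unfolding sample_sd_def mean_restrict by (auto intro!: arg_cong[where f=sqrt])

lemma sample_mean_shift: "n \<ge> 1 \<Longrightarrow> sample_mean (\<lambda>i \<omega>. X i \<omega> + \<delta>) n \<omega> = sample_mean X n \<omega> + \<delta>"
  by (simp add: sample_mean_def sum.distrib field_simps)

lemma sample_sd_shift: "n \<ge> 1 \<Longrightarrow> sample_sd (\<lambda>i \<omega>. X i \<omega> + \<delta>) n \<omega> = sample_sd X n \<omega>"
  by (simp add: sample_sd_def sample_mean_shift)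

text \<open>
Adding \<open>\<delta>\<close> to the sample mean is the same as translating every observation by \<open>\<delta>\<close>, which
leaves the standard deviation alone. So the shift moves from the event to the density, and the
two probabilities to be compared are masses of one and the same cone.
\<close>

lemma (in prob_space) prob_shifted_eq_cone:
  assumes ind: "indep_vars (\<lambda>_. borel) X {1..}"
    and dist: "\<And>i. i \<ge> 1 \<Longrightarrow> distributed M lborel (X i) (\<lambda>x. ennreal (g x))"
    and g [measurable]: "g \<in> borel_measurable borel"
    and n: "n \<ge> 1"
  shows "\<P>(\<omega> in M. sample_mean X n \<omega> + \<delta> \<ge> a * sample_sd X n \<omega>)
    = measure (iid (\<lambda>x. g (x - \<delta>)) n) (mean_sd_cone n a)"
    (is "?P = _")
proof -
  let ?Y = "\<lambda>i \<omega>. X i \<omega> + \<delta>" and ?g = "\<lambda>x. g (x - \<delta>)"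
  have indY: "indep_vars (\<lambda>_. borel) ?Y {1..}"
    using indep_vars_compose2[OF ind, of "\<lambda>_ x. x + \<delta>" "\<lambda>_. borel"] by simp
  have distY: "distributed M lborel (?Y i) (\<lambda>x. ennreal (?g x))" if "i \<ge> 1" for i
    using distributed_affine[OF dist[OF that], of 1 \<delta>]
    by (simp add: add.commute divide_ennreal_def)
  have law: "distr M (Leb n) (\<lambda>\<omega>. \<lambda>i\<in>{1..n}. ?Y i \<omega>) = iid ?g n"
    by (rule joint_law[OF indY distY _ n]) measurable
  have rv: "random_variable borel (?Y i)" if "i \<ge> 1" for i
    using distributed_measurable[OF distY[OF that]] by simp
  have meas: "(\<lambda>\<omega>. \<lambda>i\<in>{1..n}. ?Y i \<omega>) \<in> measurable M (Leb n)"
    using rv by (intro measurable_restrict) simp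
  have "measure (iid ?g n) (mean_sd_cone n a)
    = prob ((\<lambda>\<omega>. \<lambda>i\<in>{1..n}. ?Y i \<omega>) -` mean_sd_cone n a \<inter> space M)"
    unfolding law[symmetric] by (rule measure_distr[OF meas cone_sets])
  also have "(\<lambda>\<omega>. \<lambda>i\<in>{1..n}. ?Y i \<omega>) -` mean_sd_cone n a \<inter> space M
    = {\<omega> \<in> space M. sample_mean X n \<omega> + \<delta> \<ge> a * sample_sd X n \<omega>}"
    unfolding vimage_def Int_def mem_Collect_eq mean_sd_cone_def mean_restrict[of n ?Y]
      sd_restrict[of n ?Y] sample_mean_shift[OF n, of X \<delta>] sample_sd_shift[OF n, of X \<delta>]
    using measurable_space[OF meas] by blast
  finally show ?thesis by simp
qed

section \<open>Dilations of the cone\<close>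

text \<open>
It suffices to check boxes, where it is the scaling of Lebesgue measure on the line in each
of the \<open>n\<close> coordinates.
\<close>

lemma Leb_scale:
  assumes "c > 0"
  shows "density (distr (Leb n) (Leb n) (\<lambda>x. \<lambda>i\<in>{1..n}. c * x i)) (\<lambda>_. ennreal (c ^ n)) = Leb n"
    (is "?P = _")
proof -
  interpret L: product_sigma_finite "\<lambda>_::nat. lborel :: real measure" ..
  let ?T = "\<lambda>x. \<lambda>i\<in>{1..n}. c * x i"
  have T: "?T \<in> measurable (Leb n) (Leb n)"
    by (intro measurable_restrict) auto
  have one: "emeasure lborel A = ennreal c * emeasure lborel ((*) c -` A)"
    if "A \<in> sets borel" for A :: "real set"
  proof -
    have "emeasure lborel A = emeasure (density (distr lborel borel ((*) c)) (\<lambda>_. ennreal \<bar>c\<bar>)) A"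
      using lborel_distr_mult'[of c] assms by simp
    also have "\<dots> = ennreal c * emeasure lborel ((*) c -` A)"
      using that assms by (simp add: emeasure_density nn_integral_cmult emeasure_distr)
    finally show ?thesis .
  qed
  show ?thesis
  proof (rule L.PiM_eqI)
    fix A :: "nat \<Rightarrow> real set" assume A: "\<And>i. i \<in> {1..n} \<Longrightarrow> A i \<in> sets lborel"
    have box: "Pi\<^sub>E {1..n} A \<in> sets (Leb n)"
      using A by (intro sets_PiM_I_finite) auto
    have pre: "?T -` Pi\<^sub>E {1..n} A \<inter> space (Leb n) = Pi\<^sub>E {1..n} (\<lambda>i. (*) c -` A i)"
      by (auto simp: space_PiM PiE_iff)
    have meas: "(*) c -` A i \<in> sets borel" if "i \<in> {1..n}" for i
      using measurable_sets[of "(*) c" borel borel "A i"] A[OF that] by simp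
    have "emeasure ?P (Pi\<^sub>E {1..n} A) = ennreal (c ^ n) * emeasure (Leb n) (Pi\<^sub>E {1..n} (\<lambda>i. (*) c -` A i))"
      using box T pre by (subst emeasure_density_const) (auto simp: emeasure_distr)
    also have "emeasure (Leb n) (Pi\<^sub>E {1..n} (\<lambda>i. (*) c -` A i))
      = (\<Prod>i=1..n. emeasure lborel ((*) c -` A i))"
      using meas by (intro L.emeasure_PiM) auto
    also have "ennreal (c ^ n) * \<dots> = (\<Prod>i=1..n. ennreal c * emeasure lborel ((*) c -` A i))"
      using assms by (simp add: prod.distrib ennreal_power)
    also have "\<dots> = (\<Prod>i=1..n. emeasure lborel (A i))"
      using A by (intro prod.cong refl one[symmetric]) auto
    finally show "emeasure ?P (Pi\<^sub>E {1..n} A) = (\<Prod>i=1..n. emeasure lborel (A i))" .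
  qed auto
qed

lemma mean_scale: "mean n (\<lambda>i\<in>{1..n}. c * x i) = c * mean n x"
  by (simp add: sample_mean_def sum_distrib_left)

lemma sd_scale: "c \<ge> 0 \<Longrightarrow> sd n (\<lambda>i\<in>{1..n}. c * x i) = c * sd n x"
proof -
  assume "c \<ge> 0"
  have "(\<Sum>i=1..n. ((\<lambda>i\<in>{1..n}. c * x i) i - mean n (\<lambda>i\<in>{1..n}. c * x i))\<^sup>2)
    = c\<^sup>2 * (\<Sum>i=1..n. (x i - mean n x)\<^sup>2)"
    unfolding mean_scale sum_distrib_left
    by (intro sum.cong refl) (simp add: power2_eq_square algebra_simps)
  then show ?thesis
    unfolding sample_sd_def using \<open>c \<ge> 0\<close>
    by (simp add: real_sqrt_mult real_sqrt_divide)
qed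

text \<open>
The cone is invariant under positive dilations, so the part of it below height \<open>t\<close> is the
\<open>t\<close>-fold dilate of the part below height 1. This replaces integration in coordinates adapted
to the diagonal: the mean has density proportional to \<open>t ^ (n - 1)\<close> under Lebesgue measure
on the cone.
\<close>

lemma emeasure_cone_scale:
  assumes "t > 0"
  shows "emeasure (Leb n) {x \<in> mean_sd_cone n a. mean n x \<le> t}
    = ennreal (t ^ n) * emeasure (Leb n) {x \<in> mean_sd_cone n a. mean n x \<le> 1}"
proof -
  let ?T = "\<lambda>x. \<lambda>i\<in>{1..n}. t * x i" and ?A = "\<lambda>t. {x \<in> mean_sd_cone n a. mean n x \<le> t}"
  have T: "?T \<in> measurable (Leb n) (Leb n)"
    by (intro measurable_restrict) auto
  have pre: "?T -` ?A t \<inter> space (Leb n) = ?A 1"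
  proof (rule set_eqI)
    fix x
    have "a * (t * sd n x) \<le> t * mean n x \<longleftrightarrow> a * sd n x \<le> mean n x"
      using assms by (simp add: mult.left_commute[of a])
    moreover have "t * mean n x \<le> t \<longleftrightarrow> mean n x \<le> 1"
      using assms by simp
    moreover have "?T x \<in> space (Leb n)" if "x \<in> space (Leb n)"
      using measurable_space[OF T that] .
    ultimately show "x \<in> ?T -` ?A t \<inter> space (Leb n) \<longleftrightarrow> x \<in> ?A 1"
      unfolding vimage_def Int_iff mem_Collect_eq mean_sd_cone_def mean_scale
        sd_scale[OF less_imp_le[OF assms]]
      by blast
  qed
  have "emeasure (Leb n) (?A t)
    = emeasure (density (distr (Leb n) (Leb n) ?T) (\<lambda>_. ennreal (t ^ n))) (?A t)"
    unfolding Leb_scale[OF assms] ..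
  also have "\<dots> = ennreal (t ^ n) * emeasure (distr (Leb n) (Leb n) ?T) (?A t)"
    by (rule emeasure_density_const) (use cone_below_sets[of n a t] in simp)
  also have "emeasure (distr (Leb n) (Leb n) ?T) (?A t) = emeasure (Leb n) (?A 1)"
    unfolding emeasure_distr[OF T cone_below_sets] pre ..
  finally show ?thesis .
qed

text \<open>
The index sets are \<open>{1..n}\<close>; rewriting the lower bound to \<open>Suc 0\<close> would only obscure the goals.
\<close>

declare One_nat_def [simp del]

section \<open>Mean and standard deviation of a vector\<close>

lemma sum_deviations: "n \<ge> 1 \<Longrightarrow> (\<Sum>i=1..n. x i - mean n x) = 0"
  by (simp add: sample_mean_def sum_subtractf)

lemma sum_square_deviations:
  assumes "n \<ge> 1"
  shows "(\<Sum>i=1..n. (x i - mean n x)\<^sup>2) = real n * (sd n x)\<^sup>2"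
proof -
  have "(sd n x)\<^sup>2 = (1 / real n) * (\<Sum>i=1..n. (x i - mean n x)\<^sup>2)"
    unfolding sample_sd_def by (rule real_sqrt_pow2) (auto intro!: divide_nonneg_nonneg sum_nonneg)
  then show ?thesis
    using assms by (simp add: field_simps)
qed

lemma sd_nonneg [simp]: "sd n x \<ge> 0"
  unfolding sample_sd_def by (auto intro!: real_sqrt_ge_zero divide_nonneg_nonneg sum_nonneg)

lemma deviation_le_sd:
  assumes "n \<ge> 1" "i \<in> {1..n}"
  shows "\<bar>x i - mean n x\<bar> \<le> sqrt (real n) * sd n x"
proof -
  have "(x i - mean n x)\<^sup>2 \<le> (\<Sum>i=1..n. (x i - mean n x)\<^sup>2)"
    using assms(2) by (intro member_le_sum) auto
  also have "\<dots> = (sqrt (real n) * sd n x)\<^sup>2"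
    using assms(1) by (simp add: sum_square_deviations power_mult_distrib)
  finally show ?thesis
    by (metis abs_le_square_iff abs_of_nonneg mult_nonneg_nonneg real_sqrt_ge_zero of_nat_0_le_iff
        sd_nonneg)
qed

lemma sd_le_of_deviation_le:
  assumes "n \<ge> 1" "r \<ge> 0" and le: "\<And>i. i \<in> {1..n} \<Longrightarrow> \<bar>x i - mean n x\<bar> \<le> r"
  shows "sd n x \<le> r"
proof -
  have "(\<Sum>i=1..n. (x i - mean n x)\<^sup>2) \<le> (\<Sum>i=1..n. r\<^sup>2)"
    using le by (intro sum_mono) (metis abs_le_square_iff abs_of_nonneg assms(2))
  then have "real n * (sd n x)\<^sup>2 \<le> real n * r\<^sup>2"
    using assms(1) by (simp add: sum_square_deviations)
  then have "(sd n x)\<^sup>2 \<le> r\<^sup>2"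
    using assms(1) by simp
  then show ?thesis
    using assms(2) by (rule power2_le_imp_le)
qed

lemma mean_absolute_deviation_le_sd:
  assumes "n \<ge> 1"
  shows "(\<Sum>i=1..n. \<bar>x i - mean n x\<bar>) \<le> real n * sd n x"
proof -
  have "(\<Sum>i=1..n. \<bar>x i - mean n x\<bar>)\<^sup>2 \<le> (\<Sum>i=1..n. \<bar>x i - mean n x\<bar>\<^sup>2) * real (card {1..n})"
    by (rule sum_squared_le_sum_of_squares)
  also have "\<dots> = (real n * sd n x)\<^sup>2"
    using sum_square_deviations[OF assms, of x] by (simp add: power2_eq_square)
  finally show ?thesis
    by (rule power2_le_imp_le) simp
qed

lemma cone_sd_le:
  assumes "a > 0" "x \<in> mean_sd_cone n a"
  shows "0 \<le> mean n x" "sd n x \<le> mean n x / a"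
proof -
  have le: "a * sd n x \<le> mean n x"
    using assms(2) by (simp add: mean_sd_cone_def)
  moreover have "0 \<le> a * sd n x"
    using assms(1) by simp
  ultimately show "0 \<le> mean n x" by linarith
  show "sd n x \<le> mean n x / a"
    using le assms(1) by (simp add: field_simps)
qed

section \<open>The volume of the cone\<close>

lemma emeasure_Leb_box:
  "A \<in> sets borel \<Longrightarrow> emeasure (Leb n) (Pi\<^sub>E {1..n} (\<lambda>_. A)) = emeasure lborel A ^ n"
proof -
  interpret L: product_sigma_finite "\<lambda>_::nat. lborel :: real measure" ..
  show "A \<in> sets borel \<Longrightarrow> emeasure (Leb n) (Pi\<^sub>E {1..n} (\<lambda>_. A)) = emeasure lborel A ^ n"
    by (subst L.emeasure_PiM) auto
qed

text \<open>
On the cone a bounded mean bounds the standard deviation and hence every coordinate, so the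
piece lies in a box.
\<close>

lemma cone_volume_finite:
  assumes "a > 0" "n \<ge> 1"
  shows "emeasure (Leb n) {x \<in> mean_sd_cone n a. mean n x \<le> 1} < \<infinity>"
proof -
  let ?r = "sqrt (real n) / a"
  have "{x \<in> mean_sd_cone n a. mean n x \<le> 1} \<subseteq> Pi\<^sub>E {1..n} (\<lambda>_. {- ?r..1 + ?r})"
  proof
    fix x assume x: "x \<in> {x \<in> mean_sd_cone n a. mean n x \<le> 1}"
    then have m: "0 \<le> mean n x" "mean n x \<le> 1" and sd: "sd n x \<le> mean n x / a"
      using cone_sd_le[OF assms(1)] by auto
    have "sqrt (real n) * sd n x \<le> sqrt (real n) * (1 / a)"
      using order_trans[OF sd divide_right_mono[OF m(2)]] assms(1) by (intro mult_left_mono) auto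
    then have "\<bar>x i - mean n x\<bar> \<le> ?r" if "i \<in> {1..n}" for i
      using deviation_le_sd[OF assms(2) that, of x] by simp
    then have "x i \<in> {- ?r..1 + ?r}" if "i \<in> {1..n}" for i
      using m that by (force simp: abs_le_iff)
    moreover have "x \<in> space (Leb n)"
      using x by (simp add: mean_sd_cone_def)
    ultimately show "x \<in> Pi\<^sub>E {1..n} (\<lambda>_. {- ?r..1 + ?r})"
      by (auto simp: space_PiM PiE_iff)
  qed
  then have "emeasure (Leb n) {x \<in> mean_sd_cone n a. mean n x \<le> 1}
    \<le> emeasure (Leb n) (Pi\<^sub>E {1..n} (\<lambda>_. {- ?r..1 + ?r}))"
    by (rule emeasure_mono) (auto intro!: sets_PiM_I_finite)
  also have "\<dots> < \<infinity>"
    using assms by (subst emeasure_Leb_box) (auto simp: power_less_top_ennreal)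
  finally show ?thesis .
qed

text \<open>
A small cube \<open>{1/2..1/2 + \<eta>}\<close> on the diagonal lies inside the cone.
\<close>

lemma cone_volume_positive:
  assumes "a > 0" "n \<ge> 1"
  shows "emeasure (Leb n) {x \<in> mean_sd_cone n a. mean n x \<le> 1} > 0"
proof -
  define \<eta> where "\<eta> = min (1/2) (1 / (2 * a))"
  have \<eta>: "\<eta> > 0" "\<eta> \<le> 1/2" "a * \<eta> \<le> 1/2"
    using assms(1) by (auto simp: \<eta>_def min_def field_simps)
  have "Pi\<^sub>E {1..n} (\<lambda>_. {1/2..1/2 + \<eta>}) \<subseteq> {x \<in> mean_sd_cone n a. mean n x \<le> 1}"
  proof
    fix x assume x: "x \<in> Pi\<^sub>E {1..n} (\<lambda>_. {1/2..1/2 + \<eta>})"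
    then have xi: "1/2 \<le> x i" "x i \<le> 1/2 + \<eta>" if "i \<in> {1..n}" for i
      using that by (auto simp: PiE_iff)
    have "(\<Sum>i=1..n. 1/2) \<le> (\<Sum>i=1..n. x i)" "(\<Sum>i=1..n. x i) \<le> (\<Sum>i=1..n. 1/2 + \<eta>)"
      using xi sum_mono[of "{1..n}" "\<lambda>_. 1/2" x] sum_mono[of "{1..n}" x "\<lambda>_. 1/2 + \<eta>"] by simp_all
    then have m: "1/2 \<le> mean n x" "mean n x \<le> 1/2 + \<eta>"
      using assms(2) by (auto simp: sample_mean_def field_simps)
    have "sd n x \<le> \<eta>"
    proof (rule sd_le_of_deviation_le[OF assms(2)])
      show "\<bar>x i - mean n x\<bar> \<le> \<eta>" if "i \<in> {1..n}" for i
        using xi[OF that] m by (simp add: abs_le_iff)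
    qed (use \<eta> in auto)
    then have "a * sd n x \<le> a * \<eta>"
      using assms(1) by (intro mult_left_mono) auto
    then have "a * sd n x \<le> mean n x"
      using \<eta>(3) m(1) by linarith
    moreover have "x \<in> space (Leb n)"
      using x by (auto simp: space_PiM PiE_iff)
    ultimately show "x \<in> {x \<in> mean_sd_cone n a. mean n x \<le> 1}"
      using m \<eta>(2) by (simp add: mean_sd_cone_def)
  qed
  then have "emeasure (Leb n) (Pi\<^sub>E {1..n} (\<lambda>_. {1/2..1/2 + \<eta>}))
    \<le> emeasure (Leb n) {x \<in> mean_sd_cone n a. mean n x \<le> 1}"
    by (rule emeasure_mono) (rule cone_below_sets)
  moreover have "0 < emeasure (Leb n) (Pi\<^sub>E {1..n} (\<lambda>_. {1/2..1/2 + \<eta>}))"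
    using \<eta>(1) by (subst emeasure_Leb_box) (auto simp: ennreal_power)
  ultimately show ?thesis
    by (rule less_le_trans[rotated])
qed

lemma emeasure_cone_below:
  assumes "a > 0" "n \<ge> 1" "t > 0"
  shows "emeasure (Leb n) {x \<in> mean_sd_cone n a. mean n x \<le> t} = ennreal (t ^ n * cone_volume n a)"
proof -
  have "emeasure (Leb n) {x \<in> mean_sd_cone n a. mean n x \<le> 1} = ennreal (cone_volume n a)"
    unfolding cone_volume_def using cone_volume_finite[OF assms(1,2)]
    by (intro emeasure_eq_ennreal_measure) auto
  then show ?thesis
    unfolding emeasure_cone_scale[OF assms(3)]
    using assms(3) by (simp add: ennreal_mult' cone_volume_def)
qed

lemma cone_volume_pos:
  assumes "a > 0" "n \<ge> 1"
  shows "cone_volume n a > 0"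
  using cone_volume_positive[OF assms] unfolding emeasure_cone_below[OF assms zero_less_one]
  by simp

lemma emeasure_cone_slab:
  assumes "a > 0" "n \<ge> 1" "0 < s" "s \<le> t"
  shows "emeasure (Leb n) {x \<in> mean_sd_cone n a. s < mean n x \<and> mean n x \<le> t}
    = ennreal ((t ^ n - s ^ n) * cone_volume n a)"
proof -
  let ?A = "\<lambda>t. {x \<in> mean_sd_cone n a. mean n x \<le> t}"
  have split: "{x \<in> mean_sd_cone n a. s < mean n x \<and> mean n x \<le> t} = ?A t - ?A s"
    using assms by auto
  have below: "emeasure (Leb n) (?A u) = ennreal (u ^ n * cone_volume n a)" if "u > 0" for u
    by (rule emeasure_cone_below[OF assms(1,2) that])
  have sub: "?A s \<subseteq> ?A t"
    using assms(4) by auto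
  have fin: "emeasure (Leb n) (?A s) \<noteq> \<infinity>"
    unfolding below[OF assms(3)] by simp
  have "emeasure (Leb n) (?A t - ?A s) = emeasure (Leb n) (?A t) - emeasure (Leb n) (?A s)"
    by (rule emeasure_Diff[OF fin cone_below_sets cone_below_sets sub])
  then have "emeasure (Leb n) (?A t - ?A s)
    = ennreal (t ^ n * cone_volume n a) - ennreal (s ^ n * cone_volume n a)"
    using assms by (simp only: below[OF assms(3)] below[of t])
  also have "\<dots> = ennreal (t ^ n * cone_volume n a - s ^ n * cone_volume n a)"
    using assms cone_volume_pos[OF assms(1,2)] by (intro ennreal_minus) simp
  finally show ?thesis
    unfolding split left_diff_distrib .
qed

section \<open>The joint density on the cone\<close>

text \<open>
Here \<open>h\<close> is the logarithm of the density and \<open>h'\<close> its derivative. Bounded curvature of \<open>h\<close>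
enters only through the Lipschitz condition.
\<close>

locale log_lipschitz_density =
  fixes f h h' :: "real \<Rightarrow> real" and K B :: real
  assumes f_eq_exp: "f x = exp (h x)"
    and h_deriv: "(h has_real_derivative h' x) (at x)"
    and h'_lipschitz: "\<bar>h' x - h' y\<bar> \<le> K * \<bar>x - y\<bar>"
    and f_le: "f x \<le> B"
begin

lemma f_pos: "f x > 0"
  by (simp add: f_eq_exp)

lemma B_pos: "B > 0"
  using f_pos[of 0] f_le[of 0] by linarith

lemma K_nonneg: "K \<ge> 0"
  using h'_lipschitz[of 1 0] by simp

lemma f_continuous: "continuous_on UNIV f"
proof -
  have "continuous_on UNIV h"
    using h_deriv DERIV_isCont continuous_at_imp_continuous_on by blast
  then show ?thesis
    unfolding f_eq_exp[abs_def] by (intro continuous_intros)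
qed

lemma f_measurable [measurable]: "f \<in> borel_measurable borel"
  using borel_measurable_continuous_onI[OF f_continuous] .

lemma first_order_taylor: "\<bar>h y - h m - h' m * (y - m)\<bar> \<le> K * (y - m)\<^sup>2"
proof (cases "y = m")
  case False
  have "\<exists>\<xi>. (\<bar>\<xi> - m\<bar> \<le> \<bar>y - m\<bar>) \<and> h y - h m = (y - m) * h' \<xi>"
  proof (cases "m < y")
    case True
    then obtain \<xi> where "m < \<xi>" "\<xi> < y" "h y - h m = (y - m) * h' \<xi>"
      using MVT2[of m y h h'] h_deriv by blast
    then show ?thesis by (intro exI[of _ \<xi>]) auto
  next
    case False
    then have "y < m" using \<open>y \<noteq> m\<close> by simp
    then obtain \<xi> where "y < \<xi>" "\<xi> < m" "h m - h y = (m - y) * h' \<xi>"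
      using MVT2[of y m h h'] h_deriv by blast
    then show ?thesis by (intro exI[of _ \<xi>]) (auto simp: algebra_simps)
  qed
  then obtain \<xi> where \<xi>: "\<bar>\<xi> - m\<bar> \<le> \<bar>y - m\<bar>" "h y - h m = (y - m) * h' \<xi>"
    by blast
  have "\<bar>h y - h m - h' m * (y - m)\<bar> = \<bar>h' \<xi> - h' m\<bar> * \<bar>y - m\<bar>"
    unfolding \<xi>(2) abs_mult[symmetric] by (simp add: algebra_simps)
  also have "\<dots> \<le> (K * \<bar>y - m\<bar>) * \<bar>y - m\<bar>"
    using order_trans[OF h'_lipschitz mult_left_mono[OF \<xi>(1) K_nonneg]]
    by (intro mult_right_mono) auto
  finally show ?thesis
    by (simp add: power2_eq_square mult.assoc)
qed simp

lemma prod_f: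
  fixes y :: "nat \<Rightarrow> real"
  shows "(\<Prod>i=1..n. f (y i)) = exp (\<Sum>i=1..n. h (y i))"
  unfolding f_eq_exp by (rule exp_sum[symmetric]) simp

lemma f_power: "f y ^ n = exp (real n * h y)"
  by (simp add: f_eq_exp exp_of_nat_mult)

text \<open>
Expand around the mean: the linear terms cancel because the deviations from the mean sum to
zero, and the quadratic errors add up to \<open>n\<close> times the sample variance.
\<close>

lemma sum_log_density:
  assumes "n \<ge> 1"
  shows "\<bar>(\<Sum>i=1..n. h (x i - \<delta>)) - real n * h (mean n x - \<delta>)\<bar> \<le> K * (real n * (sd n x)\<^sup>2)"
proof -
  let ?m = "mean n x"
  \<comment> \<open>The linear term of the expansion is part of the remainder, so that it cancels in the sum.\<close>
  let ?r = "\<lambda>i. h (x i - \<delta>) - h (?m - \<delta>) - h' (?m - \<delta>) * (x i - ?m)"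
  have "(\<Sum>i=1..n. ?r i)
    = (\<Sum>i=1..n. h (x i - \<delta>)) - real n * h (?m - \<delta>) - h' (?m - \<delta>) * (\<Sum>i=1..n. x i - ?m)"
    by (simp add: sum_subtractf flip: sum_distrib_left)
  then have "(\<Sum>i=1..n. h (x i - \<delta>)) - real n * h (?m - \<delta>) = (\<Sum>i=1..n. ?r i)"
    unfolding sum_deviations[OF assms] by simp
  then have "\<bar>(\<Sum>i=1..n. h (x i - \<delta>)) - real n * h (?m - \<delta>)\<bar> \<le> (\<Sum>i=1..n. \<bar>?r i\<bar>)"
    using sum_abs[of ?r "{1..n}"] by (simp only:)
  also have "\<dots> \<le> (\<Sum>i=1..n. K * (x i - ?m)\<^sup>2)"
  proof (rule sum_mono)
    fix i
    show "\<bar>?r i\<bar> \<le> K * (x i - ?m)\<^sup>2"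
      using first_order_taylor[of "x i - \<delta>" "?m - \<delta>"] by simp
  qed
  also have "\<dots> = K * (real n * (sd n x)\<^sup>2)"
    unfolding sum_distrib_left[symmetric] sum_square_deviations[OF assms] ..
  finally show ?thesis .
qed

text \<open>
On the cone the standard deviation is at most \<open>mean / a\<close>, so the joint density is almost a
function of the mean alone.
\<close>

lemma prod_density_on_cone:
  assumes "n \<ge> 1" "a > 0" "x \<in> mean_sd_cone n a"
  shows "(\<Prod>i=1..n. f (x i - \<delta>)) \<le> (f (mean n x - \<delta>) * exp (K * (mean n x / a)\<^sup>2)) ^ n"
    and "(f (mean n x - \<delta>) * exp (- (K * (mean n x / a)\<^sup>2))) ^ n \<le> (\<Prod>i=1..n. f (x i - \<delta>))"
proof -
  have "(sd n x)\<^sup>2 \<le> (mean n x / a)\<^sup>2"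
    using cone_sd_le[OF assms(2,3)] by (intro power_mono) auto
  then have "K * (real n * (sd n x)\<^sup>2) \<le> real n * (K * (mean n x / a)\<^sup>2)"
    using K_nonneg mult_left_mono[of "(sd n x)\<^sup>2" "(mean n x / a)\<^sup>2" "K * real n"]
    by (simp add: mult_ac)
  then have le: "\<bar>(\<Sum>i=1..n. h (x i - \<delta>)) - real n * h (mean n x - \<delta>)\<bar>
      \<le> real n * (K * (mean n x / a)\<^sup>2)"
    using sum_log_density[OF assms(1), of x \<delta>] by linarith
  show "(\<Prod>i=1..n. f (x i - \<delta>)) \<le> (f (mean n x - \<delta>) * exp (K * (mean n x / a)\<^sup>2)) ^ n"
    unfolding prod_f power_mult_distrib f_power exp_of_nat_mult[symmetric] exp_add[symmetric]
    using le unfolding exp_le_cancel_iff by linarith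
  show "(f (mean n x - \<delta>) * exp (- (K * (mean n x / a)\<^sup>2))) ^ n \<le> (\<Prod>i=1..n. f (x i - \<delta>))"
    unfolding prod_f power_mult_distrib f_power exp_of_nat_mult[symmetric] exp_add[symmetric]
    using le unfolding exp_le_cancel_iff mult_minus_right by linarith
qed

text \<open>
Translating every coordinate by \<open>- \<delta>\<close> changes the log density by \<open>- \<delta> * (\<Sum>i. h' (x i))\<close> up to
second order. On the cone the coordinates are on average close to the mean, so all values of
\<open>h'\<close> may be replaced by its value at a point \<open>z\<close> near the mean.
\<close>

lemma log_likelihood_ratio:
  assumes "n \<ge> 1" "a > 0" "x \<in> mean_sd_cone n a" and near: "\<bar>mean n x - z\<bar> \<le> \<epsilon>"
  shows "\<bar>(\<Sum>i=1..n. h (x i - \<delta>)) - (\<Sum>i=1..n. h (x i)) + real n * \<delta> * h' z\<bar>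
    \<le> real n * K * \<delta>\<^sup>2 + real n * \<bar>\<delta>\<bar> * K * (\<epsilon> + (z + \<epsilon>) / a)"
proof -
  let ?m = "mean n x"
  have summand: "\<bar>h (x i - \<delta>) - h (x i) + \<delta> * h' z\<bar>
      \<le> K * \<delta>\<^sup>2 + \<bar>\<delta>\<bar> * K * (\<bar>x i - ?m\<bar> + \<epsilon>)" for i
  proof -
    have "\<bar>h (x i - \<delta>) - h (x i) + h' (x i) * \<delta>\<bar> \<le> K * \<delta>\<^sup>2"
      using first_order_taylor[of "x i - \<delta>" "x i"] by simp
    moreover have "\<bar>\<delta> * (h' z - h' (x i))\<bar> \<le> \<bar>\<delta>\<bar> * (K * (\<bar>x i - ?m\<bar> + \<epsilon>))"
      unfolding abs_mult
    proof (rule mult_left_mono)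
      have "\<bar>h' z - h' (x i)\<bar> \<le> K * \<bar>z - x i\<bar>"
        by (rule h'_lipschitz)
      also have "\<dots> \<le> K * (\<bar>x i - ?m\<bar> + \<epsilon>)"
        using near K_nonneg by (intro mult_left_mono) auto
      finally show "\<bar>h' z - h' (x i)\<bar> \<le> K * (\<bar>x i - ?m\<bar> + \<epsilon>)" .
    qed simp
    ultimately show ?thesis
      by (simp add: algebra_simps abs_le_iff)
  qed
  have diff: "(\<Sum>i=1..n. h (x i - \<delta>)) - (\<Sum>i=1..n. h (x i)) + real n * \<delta> * h' z
    = (\<Sum>i=1..n. h (x i - \<delta>) - h (x i) + \<delta> * h' z)"
    by (simp add: sum.distrib sum_subtractf)
  have "\<bar>(\<Sum>i=1..n. h (x i - \<delta>)) - (\<Sum>i=1..n. h (x i)) + real n * \<delta> * h' z\<bar>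
    \<le> (\<Sum>i=1..n. K * \<delta>\<^sup>2 + \<bar>\<delta>\<bar> * K * (\<bar>x i - ?m\<bar> + \<epsilon>))"
    unfolding diff by (rule order_trans[OF sum_abs sum_mono[OF summand]])
  also have "\<dots> = real n * K * \<delta>\<^sup>2
      + \<bar>\<delta>\<bar> * K * ((\<Sum>i=1..n. \<bar>x i - ?m\<bar>) + real n * \<epsilon>)"
    by (simp add: sum.distrib sum_distrib_left[symmetric])
  also have "\<dots> \<le> real n * K * \<delta>\<^sup>2
      + \<bar>\<delta>\<bar> * K * (real n * ((z + \<epsilon>) / a) + real n * \<epsilon>)"
  proof -
    have "sd n x \<le> ?m / a"
      by (rule cone_sd_le[OF assms(2,3)])
    also have "\<dots> \<le> (z + \<epsilon>) / a"
      using near assms(2) by (intro divide_right_mono) auto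
    finally have "real n * sd n x \<le> real n * ((z + \<epsilon>) / a)"
      by (intro mult_left_mono) auto
    then have "(\<Sum>i=1..n. \<bar>x i - ?m\<bar>) \<le> real n * ((z + \<epsilon>) / a)"
      using mean_absolute_deviation_le_sd[OF assms(1), of x] by linarith
    then show ?thesis
      using K_nonneg by (intro add_left_mono mult_left_mono add_right_mono) auto
  qed
  finally show ?thesis
    by (simp add: algebra_simps)
qed

lemma f_shift_le:
  assumes "0 \<le> z" "z \<le> Z" "\<bar>\<delta>\<bar> \<le> 1"
  shows "f (z - \<delta>) \<le> f z * exp ((\<bar>h' 0\<bar> + K * Z + K) * \<bar>\<delta>\<bar>)"
proof -
  have "h (z - \<delta>) - h z \<le> K * \<delta>\<^sup>2 + \<bar>h' z\<bar> * \<bar>\<delta>\<bar>"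
    using first_order_taylor[of "z - \<delta>" z] abs_ge_self[of "h' z * \<delta>"] abs_ge_minus_self[of "h' z * \<delta>"]
    by (simp add: abs_le_iff abs_mult)
  also have "\<bar>h' z\<bar> \<le> \<bar>h' 0\<bar> + K * Z"
    using h'_lipschitz[of z 0] mult_left_mono[OF assms(2) K_nonneg] assms(1) by simp
  also have "K * \<delta>\<^sup>2 \<le> K * \<bar>\<delta>\<bar>"
    using K_nonneg assms(3) mult_left_mono[of "\<bar>\<delta>\<bar>" 1 "\<bar>\<delta>\<bar>"]
    by (intro mult_left_mono) (auto simp: power2_eq_square)
  finally have "h (z - \<delta>) \<le> h z + (\<bar>h' 0\<bar> + K * Z + K) * \<bar>\<delta>\<bar>"
    by (simp add: algebra_simps mult_right_mono)
  then show ?thesis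
    unfolding f_eq_exp exp_add[symmetric] by simp
qed

text \<open>
Cut the cone into \<open>N\<close> slabs of thickness \<open>\<eta>\<close> according to the mean. In a slab below height \<open>t\<close>
the volume is at most \<open>t ^ n\<close> times the unit volume and the density is about \<open>f z ^ n\<close> with
\<open>t \<le> z + \<eta>\<close>, so the mass is about \<open>((z + \<eta>) * f z) ^ n \<le> (m + \<eta> * B) ^ n\<close>. The exponential
factor collects the effect of the shift \<open>\<delta>\<close> and the error of the expansion around the mean.
\<close>

lemma emeasure_bounded_slabs:
  assumes n: "n \<ge> 1" and a: "a > 0" and \<delta>: "\<bar>\<delta>\<bar> \<le> 1" and \<eta>: "\<eta> > 0"
    and S: "S \<in> sets borel" and Z: "Z = real N * \<eta>"
    and m: "m \<ge> 0" "\<And>z. z \<in> S \<Longrightarrow> 0 \<le> z \<Longrightarrow> z \<le> Z \<Longrightarrow> z * f z \<le> m"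
  shows "emeasure (iid (\<lambda>x. f (x - \<delta>)) n) {x \<in> mean_sd_cone n a. mean n x \<in> S \<and> mean n x < Z}
    \<le> ennreal (real N * ((m + \<eta> * B) *
        exp ((\<bar>h' 0\<bar> + K * Z + K) * \<bar>\<delta>\<bar> + K * (Z / a)\<^sup>2)) ^ n * cone_volume n a)"
proof -
  define e where "e = exp ((\<bar>h' 0\<bar> + K * Z + K) * \<bar>\<delta>\<bar> + K * (Z / a)\<^sup>2)"
  define b where "b = (m + \<eta> * B) * e"
  let ?\<mu> = "iid (\<lambda>x. f (x - \<delta>)) n"
  define slab where
    "slab j = {x \<in> mean_sd_cone n a. mean n x \<in> S \<inter> {real j * \<eta>..<real (Suc j) * \<eta>}}" for j
  have meas: "slab j \<in> sets (Leb n)" for j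
    unfolding slab_def using S by (intro cone_slab_sets) auto
  have slab_le: "emeasure ?\<mu> (slab j) \<le> ennreal (b ^ n * cone_volume n a)" if j: "j < N" for j
  proof -
    let ?t = "real (Suc j) * \<eta>"
    have t: "?t > 0" "?t \<le> Z"
      using \<eta> j by (auto simp: Z intro!: mult_right_mono)
    have prod_le: "(\<Prod>i=1..n. f (x i - \<delta>)) \<le> (b / ?t) ^ n" if "x \<in> slab j" for x
    proof -
      let ?z = "mean n x"
      have x: "x \<in> mean_sd_cone n a" "?z \<in> S" "real j * \<eta> \<le> ?z" "?z < ?t"
        using that by (auto simp: slab_def)
      have z: "0 \<le> ?z" "?z \<le> Z"
        using cone_sd_le(1)[OF a x(1)] x(4) t(2) by auto
      have "?t \<le> ?z + \<eta>"
        using x(3) by (simp add: algebra_simps)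
      then have "?t * f ?z \<le> ?z * f ?z + \<eta> * f ?z"
        using f_pos[of ?z] by (metis distrib_right less_imp_le mult_right_mono)
      also have "\<dots> \<le> m + \<eta> * B"
        using m(2)[OF x(2) z] f_le[of ?z] \<eta> by (intro add_mono mult_left_mono) auto
      finally have tf: "?t * f ?z \<le> m + \<eta> * B" .
      have "?t * (f (?z - \<delta>) * exp (K * (?z / a)\<^sup>2))
        \<le> ?t * ((f ?z * exp ((\<bar>h' 0\<bar> + K * Z + K) * \<bar>\<delta>\<bar>)) * exp (K * (Z / a)\<^sup>2))"
        using f_shift_le[OF z \<delta>] z a t K_nonneg f_pos[of "?z"]
        by (intro mult_left_mono mult_mono) (auto intro!: mult_left_mono power_mono divide_right_mono)
      also have "\<dots> = (?t * f ?z) * e"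
        by (simp add: e_def exp_add)
      also have "\<dots> \<le> b"
        unfolding b_def using tf by (intro mult_right_mono) (auto simp: e_def)
      finally have "f (?z - \<delta>) * exp (K * (?z / a)\<^sup>2) \<le> b / ?t"
        using t(1) by (simp add: pos_le_divide_eq mult.commute)
      then have "(f (?z - \<delta>) * exp (K * (?z / a)\<^sup>2)) ^ n \<le> (b / ?t) ^ n"
        using f_pos[of "?z - \<delta>"] by (intro power_mono) auto
      then show ?thesis
        using prod_density_on_cone(1)[OF n a x(1), of \<delta>] by linarith
    qed
    have "emeasure ?\<mu> (slab j) \<le> ennreal ((b / ?t) ^ n) * emeasure (Leb n) (slab j)"
      using f_pos by (intro emeasure_iid_le meas prod_le) (auto simp: less_imp_le)
    also have "\<dots> \<le> ennreal ((b / ?t) ^ n) * emeasure (Leb n) {x \<in> mean_sd_cone n a. mean n x \<le> ?t}"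
      by (intro mult_left_mono emeasure_mono cone_below_sets) (auto simp: slab_def)
    also have "\<dots> = ennreal ((b / ?t) ^ n * (?t ^ n * cone_volume n a))"
    proof -
      have "b \<ge> 0"
        using m(1) \<eta> B_pos by (simp add: b_def e_def)
      then show ?thesis
        unfolding emeasure_cone_below[OF a n t(1)] using t(1) by (simp add: ennreal_mult')
    qed
    also have "(b / ?t) ^ n * (?t ^ n * cone_volume n a) = b ^ n * cone_volume n a"
      using t(1) \<eta> by (simp add: power_divide del: of_nat_Suc)
    finally show ?thesis .
  qed
  have cover: "{x \<in> mean_sd_cone n a. mean n x \<in> S \<and> mean n x < Z} \<subseteq> (\<Union>j<N. slab j)"
  proof
    fix x assume "x \<in> {x \<in> mean_sd_cone n a. mean n x \<in> S \<and> mean n x < Z}"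
    then have x: "x \<in> mean_sd_cone n a" "mean n x \<in> S" "mean n x < Z" by auto
    define j where "j = nat \<lfloor>mean n x / \<eta>\<rfloor>"
    have nn: "0 \<le> mean n x / \<eta>"
      using cone_sd_le(1)[OF a x(1)] \<eta> by simp
    have j: "real j \<le> mean n x / \<eta>" "mean n x / \<eta> < real (Suc j)"
      using nn unfolding j_def by linarith+
    then have jz: "real j * \<eta> \<le> mean n x" "mean n x < real (Suc j) * \<eta>"
      using \<eta> by (simp_all only: pos_le_divide_eq pos_divide_less_eq)
    have "real j * \<eta> < real N * \<eta>"
      using jz(1) x(3) Z by linarith
    then have "j < N"
      using \<eta> by simp
    then show "x \<in> (\<Union>j<N. slab j)"
      using x jz by (auto simp: slab_def)
  qed
  have "emeasure ?\<mu> {x \<in> mean_sd_cone n a. mean n x \<in> S \<and> mean n x < Z} \<le> emeasure ?\<mu> (\<Union>j<N. slab j)"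
    using meas by (intro emeasure_mono cover) (auto simp: sets_iid)
  also have "\<dots> \<le> (\<Sum>j<N. emeasure ?\<mu> (slab j))"
    using meas by (intro emeasure_subadditive_finite) auto
  also have "\<dots> \<le> (\<Sum>j<N. ennreal (b ^ n * cone_volume n a))"
    using slab_le by (intro sum_mono) auto
  also have "\<dots> = ennreal (real N * b ^ n * cone_volume n a)"
    by (simp add: ennreal_mult' ennreal_of_nat_eq_real_of_nat mult.assoc)
  finally show ?thesis
    by (simp only: b_def e_def)
qed

end

section \<open>Large means\<close>

text \<open>
For large means \<open>z\<close> the error \<open>n * (z / a)\<^sup>2\<close> of the expansion around the mean is out of control,
and a cruder argument takes over. By Chebyshev's inequality at most \<open>4 * n / a\<^sup>2\<close> coordinates
lie below \<open>z / 2\<close>; each other coordinate contributes \<open>C * z powr (- (1 + \<gamma>))\<close>. The exceptional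
coordinates cost at most half of the excess \<open>\<gamma>\<close> once \<open>a\<close> is large. The weight \<open>w i\<close> in the
proof is Chebyshev's bound written as one exponent valid for every coordinate.
\<close>

lemma prod_le_of_heavy_tail:
  assumes n: "n \<ge> 1" and a: "a > 0" "a\<^sup>2 \<ge> 8 * (1 + \<gamma>) / \<gamma>" and \<gamma>: "\<gamma> > 0"
    and x: "x \<in> mean_sd_cone n a" and z: "mean n x \<ge> 1"
    and g: "\<And>y. 0 \<le> g y" "\<And>y. g y \<le> C"
      "\<And>y. y \<ge> mean n x / 2 \<Longrightarrow> g y \<le> C * mean n x powr (- (1 + \<gamma>))"
  shows "(\<Prod>i=1..n. g (x i)) \<le> (C * mean n x powr (- (1 + \<gamma> / 2))) ^ n"
proof -
  define z where "z = mean n x"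
  have z1: "z \<ge> 1" using z by (simp add: z_def)
  have C: "C \<ge> 0" using g(1,2)[of 0] by linarith
  define w where "w i = - (1 + \<gamma>) + (1 + \<gamma>) * (4 * (x i - z)\<^sup>2 / z\<^sup>2)" for i
  have single: "g (x i) \<le> C * z powr (w i)" for i
  proof (cases "x i \<ge> z / 2")
    case True
    have "g (x i) \<le> C * z powr (- (1 + \<gamma>))"
      using g(3) True by (simp add: z_def)
    also have "\<dots> \<le> C * z powr (w i)"
      using C z1 \<gamma> by (intro mult_left_mono powr_mono) (auto simp: w_def)
    finally show ?thesis .
  next
    case False
    then have "(z / 2)\<^sup>2 \<le> (z - x i)\<^sup>2"
      using z1 by (intro power_mono) auto
    then have "1 \<le> 4 * (x i - z)\<^sup>2 / z\<^sup>2"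
      using z1 by (simp add: field_simps power2_commute)
    then have "0 \<le> w i"
      using \<gamma> mult_left_mono[of 1 "4 * (x i - z)\<^sup>2 / z\<^sup>2" "1 + \<gamma>"] by (simp add: w_def)
    then have "1 \<le> z powr (w i)"
      using z1 by (simp add: ge_one_powr_ge_zero)
    then have "C * 1 \<le> C * z powr (w i)"
      using C by (intro mult_left_mono) auto
    then show ?thesis
      using g(2)[of "x i"] by simp
  qed
  have "(\<Sum>i=1..n. w i) = real n * (- (1 + \<gamma>)) + (1 + \<gamma>) * (4 / z\<^sup>2 * (\<Sum>i=1..n. (x i - z)\<^sup>2))"
    unfolding w_def sum.distrib sum_distrib_left[symmetric] by (simp add: sum_distrib_left)
  also have "\<dots> = real n * (- (1 + \<gamma>) + (1 + \<gamma>) * (4 * (sd n x / z)\<^sup>2))"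
    unfolding z_def sum_square_deviations[OF n] by (simp add: power_divide algebra_simps)
  also have "\<dots> \<le> real n * (- (1 + \<gamma>) + \<gamma> / 2)"
  proof -
    have "sd n x / z \<le> 1 / a"
      using cone_sd_le(2)[OF a(1) x] z1 a(1) by (simp add: z_def field_simps)
    then have "(sd n x / z)\<^sup>2 \<le> (1 / a)\<^sup>2"
      using z1 by (intro power_mono) auto
    then have "(1 + \<gamma>) * (4 * (sd n x / z)\<^sup>2) \<le> (1 + \<gamma>) * (4 * (1 / a)\<^sup>2)"
      using \<gamma> by (intro mult_left_mono) auto
    also have "\<dots> \<le> \<gamma> / 2"
      using a \<gamma> by (simp add: field_simps)
    finally show ?thesis by (intro mult_left_mono) auto
  qed
  also have "\<dots> = - (1 + \<gamma> / 2) * real n"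
    by (simp add: algebra_simps)
  finally have sum_w: "(\<Sum>i=1..n. w i) \<le> - (1 + \<gamma> / 2) * real n" .
  have "(\<Prod>i=1..n. g (x i)) \<le> (\<Prod>i=1..n. C * z powr (w i))"
    using g(1) single by (intro prod_mono) auto
  also have "\<dots> = C ^ n * z powr (\<Sum>i=1..n. w i)"
    using z1 by (simp add: prod.distrib powr_sum)
  also have "\<dots> \<le> C ^ n * z powr (- (1 + \<gamma> / 2) * real n)"
    using C z1 sum_w by (intro mult_left_mono powr_mono) auto
  also have "\<dots> = (C * z powr (- (1 + \<gamma> / 2))) ^ n"
    using z1 n by (simp add: power_mult_distrib powr_power mult.commute)
  finally show ?thesis by (simp add: z_def)
qed

locale heavy_tailed_density = log_lipschitz_density +
  fixes \<gamma> C x\<^sub>0 :: real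
  assumes \<gamma>_pos: "\<gamma> > 0"
    and x\<^sub>0_pos: "x\<^sub>0 > 0"
    and f_tail: "x \<ge> x\<^sub>0 \<Longrightarrow> f x \<le> C * x powr (- (1 + \<gamma>))"
begin

text \<open>
Any rate \<open>M\<close> can be achieved by discarding only sufficiently large means. In the
dyadic slab from \<open>Y\<close> to \<open>2 * Y\<close> the volume factor \<open>(2 * Y) ^ n\<close> times the density bound
\<open>(D * Y powr (- (1 + \<gamma> / 2))) ^ n\<close> is \<open>(2 * D * Y powr (- (\<gamma> / 2))) ^ n\<close>: small for \<open>Y\<close> large,
and geometrically summable over the slabs.
\<close>

lemma emeasure_tail:
  assumes M: "M > 0"
  obtains Z\<^sub>0 c where "Z\<^sub>0 > 0" "c > 0"
    "\<And>Z n a \<delta>. Z \<ge> Z\<^sub>0 \<Longrightarrow> n \<ge> 1 \<Longrightarrow> a > 0 \<Longrightarrow> a\<^sup>2 \<ge> 8 * (1 + \<gamma>) / \<gamma> \<Longrightarrow> \<bar>\<delta>\<bar> \<le> 1 \<Longrightarrow>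
      emeasure (iid (\<lambda>x. f (x - \<delta>)) n) {x \<in> mean_sd_cone n a. mean n x \<ge> Z}
        \<le> ennreal (c * M ^ n * cone_volume n a)"
proof -
  \<comment> \<open>The factor \<open>4 powr (1 + \<gamma>)\<close> arises because \<open>y \<ge> z / 2\<close> gives \<open>y - \<delta> \<ge> z / 4\<close> for
    \<open>z \<ge> 4\<close>, and the tail bound is applied at \<open>y - \<delta>\<close>.\<close>
  define D where "D = B + \<bar>C\<bar> * 4 powr (1 + \<gamma>)"
  define r where "r = 2 powr (- (\<gamma> / 2))"
  define Z\<^sub>0 where "Z\<^sub>0 = max (max 4 (4 * x\<^sub>0)) ((2 * D / M) powr (2 / \<gamma>))"
  have D: "D > 0" "B \<le> D"
    using B_pos by (auto simp: D_def intro!: add_pos_nonneg)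
  have r: "0 < r" "r < 1"
    using \<gamma>_pos powr_less_mono[of "- (\<gamma> / 2)" 0 2] by (auto simp: r_def)
  show thesis
  proof (rule that[of Z\<^sub>0 "1 / (1 - r)"])
    show "Z\<^sub>0 > 0" "1 / (1 - r) > 0" using r by (auto simp: Z\<^sub>0_def)
    fix Z n a \<delta> assume Z: "Z \<ge> Z\<^sub>0" and n: "n \<ge> (1::nat)"
      and a: "a > 0" "a\<^sup>2 \<ge> 8 * (1 + \<gamma>) / \<gamma>" and \<delta>: "\<bar>\<delta>\<bar> \<le> (1::real)"
    have Z4: "Z \<ge> 4" "Z \<ge> 4 * x\<^sub>0" "Z \<ge> (2 * D / M) powr (2 / \<gamma>)"
      using Z by (auto simp: Z\<^sub>0_def)
    have "2 * D / M = ((2 * D / M) powr (2 / \<gamma>)) powr (\<gamma> / 2)"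
      using D M \<gamma>_pos by (simp add: powr_powr)
    also have "\<dots> \<le> Z powr (\<gamma> / 2)"
      using Z4(3) \<gamma>_pos by (intro powr_mono2) auto
    finally have ZM: "2 * D * Z powr (- (\<gamma> / 2)) \<le> M"
      using M Z4(1) by (simp add: powr_minus field_simps)
    let ?\<mu> = "iid (\<lambda>x. f (x - \<delta>)) n"
    define slab where "slab k = {x \<in> mean_sd_cone n a. mean n x \<in> {Z * 2 ^ k..<2 * (Z * 2 ^ k)}}" for k
    have meas: "slab k \<in> sets (Leb n)" for k
      unfolding slab_def by (intro cone_slab_sets) auto
    have vol: "cone_volume n a > 0" by (rule cone_volume_pos[OF a(1) n])
    have slab_le: "emeasure ?\<mu> (slab k) \<le> ennreal (M ^ n * cone_volume n a * r ^ k)" for k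
    proof -
      define Y where "Y = Z * 2 ^ k"
      have Y: "Y \<ge> Z"
        using Z4(1) mult_left_mono[of 1 "2 ^ k" Z] by (simp add: Y_def)
      define b where "b = D * Y powr (- (1 + \<gamma> / 2))"
      have b: "b \<ge> 0" using D by (simp add: b_def)
      have prod_le: "(\<Prod>i=1..n. f (x i - \<delta>)) \<le> b ^ n" if "x \<in> slab k" for x
      proof -
        have x: "x \<in> mean_sd_cone n a" "Y \<le> mean n x"
          using that by (auto simp: slab_def Y_def)
        have tail: "f (y - \<delta>) \<le> D * mean n x powr (- (1 + \<gamma>))" if "y \<ge> mean n x / 2" for y
        proof -
          have y: "y - \<delta> \<ge> mean n x / 4" "mean n x / 4 \<ge> x\<^sub>0" "mean n x / 4 > 0"
            using that \<delta> x(2) Y Z4 by auto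
          have scale: "(m / 4) powr (- p) = 4 powr p * m powr (- p)" for m p :: real
            using powr_divide[of m 4 "- p"] powr_minus_divide[of 4 p] by simp
          have "f (y - \<delta>) \<le> C * (y - \<delta>) powr (- (1 + \<gamma>))"
            using y by (intro f_tail) auto
          also have "\<dots> \<le> \<bar>C\<bar> * (mean n x / 4) powr (- (1 + \<gamma>))"
            using y \<gamma>_pos by (intro mult_mono powr_mono2') auto
          also have "\<dots> = (\<bar>C\<bar> * 4 powr (1 + \<gamma>)) * mean n x powr (- (1 + \<gamma>))"
            using scale[of "mean n x" "1 + \<gamma>"] by (simp only: mult.assoc)
          also have "\<dots> \<le> D * mean n x powr (- (1 + \<gamma>))"
            using B_pos by (intro mult_right_mono) (auto simp: D_def)
          finally show ?thesis .
        qed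
        have "(\<Prod>i=1..n. f (x i - \<delta>)) \<le> (D * mean n x powr (- (1 + \<gamma> / 2))) ^ n"
          using x(2) Y Z4(1) f_pos f_le order_trans[OF f_le D(2)] tail
          by (intro prod_le_of_heavy_tail[OF n a \<gamma>_pos x(1), where g="\<lambda>y. f (y - \<delta>)"])
            (auto simp: less_imp_le)
        also have "\<dots> \<le> b ^ n"
          unfolding b_def using D x(2) Y Z4(1) \<gamma>_pos
          by (intro power_mono mult_left_mono powr_mono2') auto
        finally show ?thesis .
      qed
      have "emeasure ?\<mu> (slab k) \<le> ennreal (b ^ n) * emeasure (Leb n) (slab k)"
        using f_pos by (intro emeasure_iid_le meas prod_le) (auto simp: less_imp_le)
      also have "\<dots> \<le> ennreal (b ^ n) * emeasure (Leb n) {x \<in> mean_sd_cone n a. mean n x \<le> 2 * Y}"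
        by (intro mult_left_mono emeasure_mono cone_below_sets) (auto simp: slab_def Y_def)
      also have "\<dots> = ennreal (b ^ n) * ennreal ((2 * Y) ^ n * cone_volume n a)"
        using Y Z4(1) by (subst emeasure_cone_below[OF a(1) n]) auto
      also have "\<dots> = ennreal ((b * (2 * Y)) ^ n * cone_volume n a)"
        using b by (simp add: power_mult_distrib mult.assoc flip: ennreal_mult')
      also have "\<dots> \<le> ennreal (M ^ n * cone_volume n a * r ^ k)"
      proof (rule ennreal_leI)
        have "Y powr (- (1 + \<gamma> / 2)) * Y = Y powr (- (1 + \<gamma> / 2) + 1)"
          using Y Z4(1) unfolding powr_add by simp
        then have "b * (2 * Y) = 2 * D * Y powr (- (\<gamma> / 2))"
          by (simp add: b_def)
        also have "Y powr (- (\<gamma> / 2)) = Z powr (- (\<gamma> / 2)) * r ^ k"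
          using Z4(1) by (simp add: Y_def r_def powr_mult powr_power powr_powr mult.commute
              flip: powr_realpow)
        also have "2 * D * (Z powr (- (\<gamma> / 2)) * r ^ k) = (2 * D * Z powr (- (\<gamma> / 2))) * r ^ k"
          by simp
        also have "\<dots> \<le> M * r ^ k"
          using r ZM by (intro mult_right_mono) auto
        finally have "b * (2 * Y) \<le> M * r ^ k" .
        then have "(b * (2 * Y)) ^ n \<le> (M * r ^ k) ^ n"
          using b Y Z4(1) by (intro power_mono) auto
        also have "\<dots> \<le> M ^ n * r ^ k"
        proof -
          have "(r ^ k) ^ n \<le> (r ^ k) ^ 1"
            using r n by (intro power_decreasing) (auto simp: power_le_one)
          then show ?thesis
            using M by (simp add: power_mult_distrib)
        qed
        finally show "(b * (2 * Y)) ^ n * cone_volume n a \<le> M ^ n * cone_volume n a * r ^ k"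
          using vol by (simp add: mult_right_mono mult_ac)
      qed
      finally show ?thesis .
    qed
    have cover: "{x \<in> mean_sd_cone n a. mean n x \<ge> Z} \<subseteq> (\<Union>k. slab k)"
    proof
      fix x assume "x \<in> {x \<in> mean_sd_cone n a. mean n x \<ge> Z}"
      then have x: "x \<in> mean_sd_cone n a" "mean n x \<ge> Z" by auto
      define k where "k = (LEAST k. mean n x < Z * 2 ^ Suc k)"
      have "\<exists>k. mean n x < Z * 2 ^ Suc k"
      proof -
        obtain k where "mean n x / Z < 2 ^ k"
          using real_arch_pow[of 2 "mean n x / Z"] by auto
        then have "mean n x / Z < 2 ^ Suc k"
          by (rule less_le_trans) auto
        then show ?thesis
          using Z4(1) by (auto simp: pos_divide_less_eq mult.commute)
      qed
      then have upper: "mean n x < Z * 2 ^ Suc k"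
        unfolding k_def by (rule LeastI_ex)
      have lower: "Z * 2 ^ k \<le> mean n x"
      proof (cases k)
        case 0
        then show ?thesis using x by simp
      next
        case (Suc j)
        then have "\<not> mean n x < Z * 2 ^ Suc j"
          using not_less_Least[of j "\<lambda>k. mean n x < Z * 2 ^ Suc k"] by (auto simp: k_def)
        then show ?thesis using Suc by simp
      qed
      show "x \<in> (\<Union>k. slab k)"
        using x upper lower by (auto simp: slab_def intro!: exI[of _ k])
    qed
    have "emeasure ?\<mu> {x \<in> mean_sd_cone n a. mean n x \<ge> Z} \<le> emeasure ?\<mu> (\<Union>k. slab k)"
      using meas by (intro emeasure_mono cover) auto
    also have "\<dots> \<le> (\<Sum>k. emeasure ?\<mu> (slab k))"
      using meas by (intro emeasure_subadditive_countably) auto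
    also have "\<dots> \<le> (\<Sum>k. ennreal (M ^ n * cone_volume n a * r ^ k))"
      using slab_le by (intro suminf_le) auto
    also have "\<dots> = ennreal (\<Sum>k. M ^ n * cone_volume n a * r ^ k)"
      using M r vol by (intro suminf_ennreal2) (auto intro!: summable_mult summable_geometric)
    also have "(\<Sum>k. M ^ n * cone_volume n a * r ^ k) = 1 / (1 - r) * M ^ n * cone_volume n a"
      using r by (subst suminf_mult) (auto simp: suminf_geometric summable_geometric)
    finally show "emeasure ?\<mu> {x \<in> mean_sd_cone n a. mean n x \<ge> Z}
      \<le> ennreal (1 / (1 - r) * M ^ n * cone_volume n a)" .
  qed
qed

end

section \<open>Concentration of the mean at the peak\<close>

locale peaked_density = heavy_tailed_density +
  fixes z\<^sub>0 :: real
  assumes z\<^sub>0_pos: "z\<^sub>0 > 0"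
    and peak: "z \<noteq> z\<^sub>0 \<Longrightarrow> z * f z < z\<^sub>0 * f z\<^sub>0"
begin

lemma peak_value_pos: "z\<^sub>0 * f z\<^sub>0 > 0"
  using z\<^sub>0_pos f_pos by simp

text \<open>
The peak is a critical point of \<open>ln z + h z\<close>.
\<close>

lemma h'_peak: "h' z\<^sub>0 = - (1 / z\<^sub>0)"
proof -
  have "((\<lambda>z. z * f z) has_real_derivative (f z\<^sub>0 + z\<^sub>0 * (f z\<^sub>0 * h' z\<^sub>0))) (at z\<^sub>0)"
    unfolding f_eq_exp[abs_def] by (auto intro!: derivative_eq_intros h_deriv simp: algebra_simps)
  moreover have "\<forall>z. \<bar>z\<^sub>0 - z\<bar> < 1 \<longrightarrow> z * f z \<le> z\<^sub>0 * f z\<^sub>0"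
    using peak by (metis less_imp_le order_refl)
  ultimately have "f z\<^sub>0 + z\<^sub>0 * (f z\<^sub>0 * h' z\<^sub>0) = 0"
    by (rule DERIV_local_max[OF _ zero_less_one])
  then have "f z\<^sub>0 * (1 + z\<^sub>0 * h' z\<^sub>0) = 0"
    by (simp add: algebra_simps)
  then have "1 + z\<^sub>0 * h' z\<^sub>0 = 0"
    using f_pos[of z\<^sub>0] by simp
  then show ?thesis
    using z\<^sub>0_pos by (simp add: field_simps)
qed

text \<open>
Uniqueness of the maximizer and compactness leave a gap below the maximum.
\<close>

lemma away_from_peak:
  assumes "\<epsilon> > 0"
  shows "\<exists>m. 0 \<le> m \<and> m < z\<^sub>0 * f z\<^sub>0 \<and> (\<forall>z. \<epsilon> < \<bar>z - z\<^sub>0\<bar> \<longrightarrow> 0 \<le> z \<longrightarrow> z \<le> Z \<longrightarrow> z * f z \<le> m)"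
proof -
  define T where "T = {0..Z} \<inter> {z. \<epsilon> \<le> \<bar>z - z\<^sub>0\<bar>}"
  have "closed {z. \<epsilon> \<le> \<bar>z - z\<^sub>0\<bar>}"
    by (intro closed_Collect_le continuous_intros)
  then have "compact T"
    unfolding T_def by (intro compact_Int_closed) auto
  show ?thesis
  proof (cases "T = {}")
    case True
    have "\<not> (\<epsilon> < \<bar>z - z\<^sub>0\<bar> \<and> 0 \<le> z \<and> z \<le> Z)" for z
      using True less_imp_le[of \<epsilon> "\<bar>z - z\<^sub>0\<bar>"] by (auto simp: T_def)
    then show ?thesis
      using peak_value_pos by (intro exI[of _ 0]) auto
  next
    case False
    have "continuous_on T (\<lambda>z. z * f z)"
      by (intro continuous_intros continuous_on_subset[OF f_continuous]) auto
    then obtain t where t: "t \<in> T" "\<And>z. z \<in> T \<Longrightarrow> z * f z \<le> t * f t"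
      using continuous_attains_sup[OF \<open>compact T\<close> False] by blast
    have "t \<noteq> z\<^sub>0" "0 \<le> t"
      using t(1) assms by (auto simp: T_def)
    then show ?thesis
      using peak[of t] t(2) f_pos[of t]
      by (intro exI[of _ "t * f t"]) (auto simp: T_def)
  qed
qed

text \<open>
In units of the unit volume, the mass at mean \<open>z\<close> is about \<open>(z * f z) ^ n\<close>, hence away from \<open>z\<^sub>0\<close>
it decays at a rate \<open>\<theta>\<close> strictly below the peak value. The order of choices matters: first a
height \<open>Z\<close> above which half the peak value is a valid rate, then the gap \<open>m\<close> on \<open>{0..Z}\<close>, then
a slab thickness \<open>\<eta>\<close> so fine that \<open>m + \<eta> * B\<close> is still below \<open>\<theta>\<close>. Since \<open>\<delta>\<close> tends to 0, the same
bound holds for the shifted densities.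
\<close>

lemma far_mass_le:
  assumes a: "filterlim a at_top sequentially" and \<delta>: "\<delta> \<longlonglongrightarrow> 0" and \<epsilon>: "\<epsilon> > 0"
  shows "\<exists>\<theta> c. 0 < \<theta> \<and> \<theta> < z\<^sub>0 * f z\<^sub>0 \<and> (\<forall>\<^sub>F n in sequentially.
    emeasure (iid (\<lambda>x. f (x - \<delta> n)) n) {x \<in> mean_sd_cone n (a n). \<epsilon> < \<bar>mean n x - z\<^sub>0\<bar>}
      \<le> ennreal (c * \<theta> ^ n * cone_volume n (a n)))"
proof -
  let ?M = "z\<^sub>0 * f z\<^sub>0"
  define S where "S = {z. \<epsilon> < \<bar>z - z\<^sub>0\<bar>}"
  have S: "S \<in> sets borel"
    unfolding S_def by measurable
  have half: "?M / 2 > 0"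
    using peak_value_pos by simp
  obtain Z c where Z: "Z > 0" and c: "c > 0" and tail:
    "\<And>Z' n a \<delta>. Z' \<ge> Z \<Longrightarrow> n \<ge> 1 \<Longrightarrow> a > 0 \<Longrightarrow> a\<^sup>2 \<ge> 8 * (1 + \<gamma>) / \<gamma> \<Longrightarrow> \<bar>\<delta>\<bar> \<le> 1 \<Longrightarrow>
      emeasure (iid (\<lambda>x. f (x - \<delta>)) n) {x \<in> mean_sd_cone n a. mean n x \<ge> Z'}
        \<le> ennreal (c * (?M / 2) ^ n * cone_volume n a)"
    by (rule emeasure_tail[OF half]) (rule that)
  obtain m where m: "0 \<le> m" "m < ?M" "\<And>z. z \<in> S \<Longrightarrow> 0 \<le> z \<Longrightarrow> z \<le> Z \<Longrightarrow> z * f z \<le> m"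
    using away_from_peak[OF \<epsilon>, of Z] by (auto simp: S_def)
  have "max m (?M / 2) < ?M"
    using m(2) peak_value_pos by simp
  then obtain \<theta> where \<theta>: "max m (?M / 2) < \<theta>" "\<theta> < ?M"
    using dense by blast
  \<comment> \<open>The gap between \<open>\<theta>'\<close> and \<open>\<theta>\<close> absorbs the exponential error factor.\<close>
  then obtain \<theta>' where \<theta>': "max m (?M / 2) < \<theta>'" "\<theta>' < \<theta>"
    using dense by blast
  obtain k where k: "Z * B / (\<theta>' - m) < real k"
    using reals_Archimedean2 by blast
  define N where "N = Suc k"
  define \<eta> where "\<eta> = Z / real N"
  have \<eta>: "\<eta> > 0" "Z = real N * \<eta>"
    using Z by (auto simp: \<eta>_def N_def simp del: of_nat_Suc)
  have N: "real N > 0" "Z * B / (\<theta>' - m) < real N"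
    using k by (auto simp: N_def)
  have "Z * B < (\<theta>' - m) * real N"
    using N(2) \<theta>'(1) by (simp add: pos_divide_less_eq mult.commute)
  then have "\<eta> * B < \<theta>' - m"
    using N(1) by (simp add: \<eta>_def pos_divide_less_eq)
  then have m\<eta>: "m + \<eta> * B \<le> \<theta>'"
    by simp
  let ?e = "\<lambda>n. (\<bar>h' 0\<bar> + K * Z + K) * \<bar>\<delta> n\<bar> + K * (Z / a n)\<^sup>2"
  have "(\<lambda>n. Z / a n) \<longlonglongrightarrow> 0"
    by (rule tendsto_divide_0[OF tendsto_const filterlim_at_top_imp_at_infinity[OF a]])
  then have "?e \<longlonglongrightarrow> (\<bar>h' 0\<bar> + K * Z + K) * \<bar>0\<bar> + K * 0\<^sup>2"
    by (intro tendsto_intros \<delta>)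
  then have "(\<lambda>n. \<theta>' * exp (?e n)) \<longlonglongrightarrow> \<theta>' * exp 0"
    by (intro tendsto_intros) simp
  then have ev_\<theta>: "\<forall>\<^sub>F n in sequentially. \<theta>' * exp (?e n) < \<theta>"
    using \<theta>'(2) by (intro order_tendstoD(2)) auto
  have ev_\<delta>: "\<forall>\<^sub>F n in sequentially. \<bar>\<delta> n\<bar> < 1"
    using tendsto_rabs[OF \<delta>] by (intro order_tendstoD(2)) auto
  \<comment> \<open>A value \<open>a \<ge> 1\<close> is at most its square, so this provides the bound on \<open>a\<^sup>2\<close> that the tail
    estimate asks for.\<close>
  have ev_a: "\<forall>\<^sub>F n in sequentially. a n \<ge> 1 + 8 * (1 + \<gamma>) / \<gamma>"
    using a by (simp add: filterlim_at_top)
  show ?thesis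
  proof (rule exI[of _ \<theta>], rule exI[of _ "real N + c"], intro conjI)
    show "0 < \<theta>" "\<theta> < ?M"
      using \<theta> m(1) by auto
    show "\<forall>\<^sub>F n in sequentially.
      emeasure (iid (\<lambda>x. f (x - \<delta> n)) n) {x \<in> mean_sd_cone n (a n). \<epsilon> < \<bar>mean n x - z\<^sub>0\<bar>}
        \<le> ennreal ((real N + c) * \<theta> ^ n * cone_volume n (a n))"
      using ev_\<theta> ev_\<delta> ev_a eventually_ge_at_top[of 1]
    proof eventually_elim
      case (elim n)
      let ?\<mu> = "iid (\<lambda>x. f (x - \<delta> n)) n" and ?C = "mean_sd_cone n (a n)"
      let ?v = "cone_volume n (a n)"
      have g: "8 * (1 + \<gamma>) / \<gamma> > 0"
        using \<gamma>_pos by simp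
      have an: "a n > 0" "a n \<ge> 1"
        using elim(3) g by linarith+
      have "a n * 1 \<le> a n * a n"
        using an by (intro mult_left_mono) auto
      then have an2: "(a n)\<^sup>2 \<ge> 8 * (1 + \<gamma>) / \<gamma>"
        using elim(3) by (simp add: power2_eq_square)
      have v: "?v > 0"
        by (rule cone_volume_pos[OF an(1) elim(4)])
      have "emeasure ?\<mu> {x \<in> ?C. mean n x \<in> S \<and> mean n x < Z}
        \<le> ennreal (real N * ((m + \<eta> * B) * exp (?e n)) ^ n * ?v)"
        using elim(2) by (intro emeasure_bounded_slabs[OF elim(4) an(1) _ \<eta>(1) S \<eta>(2) m(1,3)]) auto
      also have "\<dots> \<le> ennreal (real N * \<theta> ^ n * ?v)"
      proof -
        have "(m + \<eta> * B) * exp (?e n) \<le> \<theta>' * exp (?e n)"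
          using m\<eta> by (intro mult_right_mono) auto
        then have "(m + \<eta> * B) * exp (?e n) \<le> \<theta>"
          using elim(1) by linarith
        then have "((m + \<eta> * B) * exp (?e n)) ^ n \<le> \<theta> ^ n"
          using m(1) \<eta>(1) B_pos by (intro power_mono) auto
        then show ?thesis
          using v by (intro ennreal_leI mult_right_mono mult_left_mono) auto
      qed
      finally have bounded: "emeasure ?\<mu> {x \<in> ?C. mean n x \<in> S \<and> mean n x < Z}
        \<le> ennreal (real N * \<theta> ^ n * ?v)" .
      have "emeasure ?\<mu> {x \<in> ?C. mean n x \<ge> Z} \<le> ennreal (c * (?M / 2) ^ n * ?v)"
        using elim(2) by (intro tail elim(4) an(1) an2 order_refl) auto
      also have "\<dots> \<le> ennreal (c * \<theta> ^ n * ?v)"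
        using \<theta>(1) peak_value_pos v c
        by (intro ennreal_leI mult_right_mono mult_left_mono power_mono) auto
      finally have unbounded: "emeasure ?\<mu> {x \<in> ?C. mean n x \<ge> Z} \<le> ennreal (c * \<theta> ^ n * ?v)" .
      have sets1: "{x \<in> ?C. mean n x \<in> S \<and> mean n x < Z} \<in> sets (Leb n)"
        using cone_slab_sets[of "S \<inter> {..<Z}" n "a n"] S by simp
      have sets2: "{x \<in> ?C. mean n x \<ge> Z} \<in> sets (Leb n)"
        using cone_slab_sets[of "{Z..}" n "a n"] by simp
      have "emeasure ?\<mu> {x \<in> ?C. \<epsilon> < \<bar>mean n x - z\<^sub>0\<bar>}
        \<le> emeasure ?\<mu> ({x \<in> ?C. mean n x \<in> S \<and> mean n x < Z} \<union> {x \<in> ?C. mean n x \<ge> Z})"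
        using sets1 sets2 by (intro emeasure_mono sets.Un) (auto simp: S_def)
      also have "\<dots> \<le> ennreal (real N * \<theta> ^ n * ?v) + ennreal (c * \<theta> ^ n * ?v)"
        using sets1 sets2 bounded unbounded
        by (intro order_trans[OF emeasure_subadditive] add_mono) auto
      also have "\<dots> = ennreal ((real N + c) * \<theta> ^ n * ?v)"
        using v c \<theta> m(1) by (simp add: algebra_simps flip: ennreal_plus)
      finally show ?case .
    qed
  qed
qed

text \<open>
The counterpart of \<open>far_mass_le\<close>: every rate \<open>\<rho>\<close> below the peak value is exceeded by the mass
of a single thin slab just above \<open>z\<^sub>0\<close>.
\<close>

lemma near_mass_ge:
  assumes a: "filterlim a at_top sequentially" and \<epsilon>: "\<epsilon> > 0"
    and \<rho>: "0 < \<rho>" "\<rho> < z\<^sub>0 * f z\<^sub>0"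
  shows "\<exists>c>0. \<forall>\<^sub>F n in sequentially. ennreal (c * \<rho> ^ n * cone_volume n (a n))
    \<le> emeasure (iid f n) {x \<in> mean_sd_cone n (a n). \<bar>mean n x - z\<^sub>0\<bar> \<le> \<epsilon>}"
proof -
  \<comment> \<open>The gap between \<open>\<rho>\<close> and \<open>\<rho>'\<close> absorbs the error of the expansion around the mean.\<close>
  obtain \<rho>' where \<rho>': "\<rho> < \<rho>'" "\<rho>' < z\<^sub>0 * f z\<^sub>0"
    using dense[OF \<rho>(2)] by blast
  have "isCont (\<lambda>z. z\<^sub>0 * f z) z\<^sub>0"
    using f_continuous by (intro continuous_intros) (simp add: continuous_on_eq_continuous_at)
  then have "\<forall>\<^sub>F z in at z\<^sub>0. \<rho>' < z\<^sub>0 * f z"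
    unfolding isCont_def by (rule order_tendstoD(1)) (rule \<rho>'(2))
  then obtain b where b: "b > 0" "\<And>z. z \<noteq> z\<^sub>0 \<Longrightarrow> dist z z\<^sub>0 < b \<Longrightarrow> \<rho>' < z\<^sub>0 * f z"
    unfolding eventually_at by blast
  define r where "r = min \<epsilon> (b / 2)"
  have r: "r > 0" "r \<le> \<epsilon>" "r < b"
    using b(1) \<epsilon> by (auto simp: r_def)
  let ?e = "\<lambda>n. K * ((z\<^sub>0 + r) / a n)\<^sup>2"
  have "(\<lambda>n. (z\<^sub>0 + r) / a n) \<longlonglongrightarrow> 0"
    by (rule tendsto_divide_0[OF tendsto_const filterlim_at_top_imp_at_infinity[OF a]])
  then have "?e \<longlonglongrightarrow> K * 0\<^sup>2"
    by (intro tendsto_intros)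
  then have "(\<lambda>n. \<rho>' * exp (- ?e n)) \<longlonglongrightarrow> \<rho>' * exp (- 0)"
    by (intro tendsto_intros) simp
  then have ev_\<rho>: "\<forall>\<^sub>F n in sequentially. \<rho> < \<rho>' * exp (- ?e n)"
    using \<rho>'(1) by (intro order_tendstoD(1)) auto
  have ev_a: "\<forall>\<^sub>F n in sequentially. a n \<ge> 1"
    using a by (simp add: filterlim_at_top)
  have "\<forall>\<^sub>F n in sequentially. ennreal (r / z\<^sub>0 * \<rho> ^ n * cone_volume n (a n))
    \<le> emeasure (iid f n) {x \<in> mean_sd_cone n (a n). \<bar>mean n x - z\<^sub>0\<bar> \<le> \<epsilon>}"
    using ev_\<rho> ev_a eventually_ge_at_top[of 1]
  proof eventually_elim
    case (elim n)
    have an: "a n > 0" using elim(2) by simp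
    let ?C = "mean_sd_cone n (a n)" and ?v = "cone_volume n (a n)"
    let ?slab = "{x \<in> ?C. z\<^sub>0 < mean n x \<and> mean n x \<le> z\<^sub>0 + r}"
    have v: "?v > 0"
      by (rule cone_volume_pos[OF an elim(3)])
    have prod_ge: "(\<rho> / z\<^sub>0) ^ n \<le> (\<Prod>i=1..n. f (x i))" if "x \<in> ?slab" for x
    proof -
      let ?z = "mean n x"
      have x: "x \<in> ?C" "z\<^sub>0 < ?z" "?z \<le> z\<^sub>0 + r"
        using that by auto
      have "\<rho> < \<rho>' * exp (- ?e n)"
        by (rule elim(1))
      also have "\<dots> \<le> (z\<^sub>0 * f ?z) * exp (- (K * (?z / a n)\<^sup>2))"
      proof (rule mult_mono)
        show "\<rho>' \<le> z\<^sub>0 * f ?z"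
          using b(2)[of ?z] x r by (simp add: dist_real_def)
        show "exp (- ?e n) \<le> exp (- (K * (?z / a n)\<^sup>2))"
          using x z\<^sub>0_pos an K_nonneg by (auto intro!: mult_left_mono power_mono divide_right_mono)
        show "0 \<le> z\<^sub>0 * f ?z"
          using z\<^sub>0_pos f_pos[of ?z] by simp
      qed simp
      finally have "\<rho> / z\<^sub>0 \<le> f ?z * exp (- (K * (?z / a n)\<^sup>2))"
        using z\<^sub>0_pos by (simp add: field_simps)
      then have "(\<rho> / z\<^sub>0) ^ n \<le> (f ?z * exp (- (K * (?z / a n)\<^sup>2))) ^ n"
        using \<rho>(1) z\<^sub>0_pos by (intro power_mono) auto
      also have "\<dots> \<le> (\<Prod>i=1..n. f (x i))"
        using prod_density_on_cone(2)[OF elim(3) an x(1), of 0] by simp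
      finally show ?thesis .
    qed
    have slab_sets: "?slab \<in> sets (Leb n)"
      using cone_slab_sets[of "{z\<^sub>0<..z\<^sub>0 + r}" n "a n"] by simp
    have near_sets: "{x \<in> ?C. \<bar>mean n x - z\<^sub>0\<bar> \<le> \<epsilon>} \<in> sets (Leb n)"
      using cone_slab_sets[of "{z. \<bar>z - z\<^sub>0\<bar> \<le> \<epsilon>}" n "a n"] by simp
    obtain k where k: "n = Suc k"
      using elim(3) by (cases n) auto
    \<comment> \<open>The slab has at least a constant fraction of the volume below \<open>z\<^sub>0\<close>.\<close>
    have "r / z\<^sub>0 * z\<^sub>0 ^ n \<le> (z\<^sub>0 + r) ^ n - z\<^sub>0 ^ n"
    proof -
      have "(z\<^sub>0 + r) * z\<^sub>0 ^ k \<le> (z\<^sub>0 + r) * (z\<^sub>0 + r) ^ k"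
        using z\<^sub>0_pos r by (intro mult_left_mono power_mono) auto
      then show ?thesis
        using z\<^sub>0_pos by (simp add: k algebra_simps)
    qed
    then have "(\<rho> / z\<^sub>0) ^ n * (r / z\<^sub>0 * z\<^sub>0 ^ n) \<le> (\<rho> / z\<^sub>0) ^ n * ((z\<^sub>0 + r) ^ n - z\<^sub>0 ^ n)"
      using \<rho>(1) z\<^sub>0_pos by (intro mult_left_mono) auto
    then have "r / z\<^sub>0 * \<rho> ^ n \<le> (\<rho> / z\<^sub>0) ^ n * ((z\<^sub>0 + r) ^ n - z\<^sub>0 ^ n)"
      using z\<^sub>0_pos by (simp add: power_divide mult.commute)
    then have "r / z\<^sub>0 * \<rho> ^ n * ?v \<le> (\<rho> / z\<^sub>0) ^ n * ((z\<^sub>0 + r) ^ n - z\<^sub>0 ^ n) * ?v"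
      using v by (intro mult_right_mono) auto
    then have "ennreal (r / z\<^sub>0 * \<rho> ^ n * ?v)
      \<le> ennreal ((\<rho> / z\<^sub>0) ^ n * (((z\<^sub>0 + r) ^ n - z\<^sub>0 ^ n) * ?v))"
      unfolding mult.assoc by (rule ennreal_leI)
    also have "\<dots> = ennreal ((\<rho> / z\<^sub>0) ^ n) * emeasure (Leb n) ?slab"
      using \<rho>(1) z\<^sub>0_pos r(1)
      by (subst emeasure_cone_slab[OF an elim(3) z\<^sub>0_pos]) (auto simp: ennreal_mult')
    also have "\<dots> \<le> emeasure (iid f n) ?slab"
      using f_pos by (intro emeasure_iid_ge slab_sets prod_ge) (auto simp: less_imp_le)
    also have "\<dots> \<le> emeasure (iid f n) {x \<in> ?C. \<bar>mean n x - z\<^sub>0\<bar> \<le> \<epsilon>}"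
      using r(2) near_sets by (intro emeasure_mono) auto
    finally show ?case .
  qed
  then show ?thesis
    using r(1) z\<^sub>0_pos by (intro exI[of _ "r / z\<^sub>0"]) auto
qed

text \<open>
Near the peak the log likelihood ratio is about \<open>- n * \<delta> n * h' z\<^sub>0\<close>, whose limit is \<open>d / z\<^sub>0\<close>.
\<close>

lemma near_likelihood_ratio:
  assumes a: "filterlim a at_top sequentially" and d: "(\<lambda>n. real n * \<delta> n) \<longlonglongrightarrow> d"
    and \<delta>: "\<delta> \<longlonglongrightarrow> 0" and \<kappa>: "\<kappa> > 0"
  shows "\<exists>\<epsilon>>0. \<forall>\<^sub>F n in sequentially. \<forall>x\<in>mean_sd_cone n (a n). \<bar>mean n x - z\<^sub>0\<bar> \<le> \<epsilon> \<longrightarrow>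
    \<bar>(\<Sum>i=1..n. h (x i - \<delta> n)) - (\<Sum>i=1..n. h (x i)) - d / z\<^sub>0\<bar> \<le> \<kappa>"
proof -
  \<comment> \<open>The error has limit \<open>\<bar>d\<bar> * K * \<epsilon>\<close>, which has to be below \<open>\<kappa>\<close>; the summand 1 avoids a zero
    denominator.\<close>
  define \<epsilon> where "\<epsilon> = \<kappa> / (\<bar>d\<bar> * K + 1)"
  have dK: "\<bar>d\<bar> * K + 1 > 0"
    using K_nonneg by (simp add: add_nonneg_pos)
  then have \<epsilon>: "\<epsilon> > 0" "\<bar>d\<bar> * K * \<epsilon> < \<kappa>"
    using \<kappa> by (auto simp: \<epsilon>_def field_simps)
  let ?r = "\<lambda>n. \<bar>real n * \<delta> n - d\<bar> / z\<^sub>0 + \<bar>real n * \<delta> n\<bar> * \<bar>\<delta> n\<bar> * K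
    + \<bar>real n * \<delta> n\<bar> * K * (\<epsilon> + (z\<^sub>0 + \<epsilon>) / a n)"
  have "(\<lambda>n. (z\<^sub>0 + \<epsilon>) / a n) \<longlonglongrightarrow> 0"
    by (rule tendsto_divide_0[OF tendsto_const filterlim_at_top_imp_at_infinity[OF a]])
  then have "?r \<longlonglongrightarrow> \<bar>d - d\<bar> / z\<^sub>0 + \<bar>d\<bar> * \<bar>0\<bar> * K + \<bar>d\<bar> * K * (\<epsilon> + 0)"
    using z\<^sub>0_pos by (intro tendsto_intros d \<delta>) auto
  then have "\<forall>\<^sub>F n in sequentially. ?r n < \<kappa>"
    using \<epsilon>(2) by (intro order_tendstoD(2)) auto
  moreover have "\<forall>\<^sub>F n in sequentially. a n \<ge> 1"
    using a by (simp add: filterlim_at_top)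
  ultimately have "\<forall>\<^sub>F n in sequentially. \<forall>x\<in>mean_sd_cone n (a n). \<bar>mean n x - z\<^sub>0\<bar> \<le> \<epsilon> \<longrightarrow>
    \<bar>(\<Sum>i=1..n. h (x i - \<delta> n)) - (\<Sum>i=1..n. h (x i)) - d / z\<^sub>0\<bar> \<le> \<kappa>"
    using eventually_ge_at_top[of 1]
  proof eventually_elim
    case (elim n)
    show ?case
    proof (intro ballI impI)
      fix x assume x: "x \<in> mean_sd_cone n (a n)" "\<bar>mean n x - z\<^sub>0\<bar> \<le> \<epsilon>"
      have an: "a n > 0" using elim(2) by simp
      let ?\<Delta> = "(\<Sum>i=1..n. h (x i - \<delta> n)) - (\<Sum>i=1..n. h (x i))"
      have triangle: "\<bar>p - r\<bar> \<le> \<bar>p - q\<bar> + \<bar>q - r\<bar>" for p q r :: real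
        by linarith
      have regroup: "real n * K * u\<^sup>2 + real n * u * K * w = real n * u * u * K + real n * u * K * w"
        for u w :: real
        by (simp add: power2_eq_square)
      have "\<bar>?\<Delta> - real n * \<delta> n / z\<^sub>0\<bar>
        \<le> real n * K * (\<delta> n)\<^sup>2 + real n * \<bar>\<delta> n\<bar> * K * (\<epsilon> + (z\<^sub>0 + \<epsilon>) / a n)"
        using log_likelihood_ratio[OF elim(3) an x, of "\<delta> n"] by (simp add: h'_peak)
      also have "real n * K * (\<delta> n)\<^sup>2 + real n * \<bar>\<delta> n\<bar> * K * (\<epsilon> + (z\<^sub>0 + \<epsilon>) / a n)
        = \<bar>real n * \<delta> n\<bar> * \<bar>\<delta> n\<bar> * K
          + \<bar>real n * \<delta> n\<bar> * K * (\<epsilon> + (z\<^sub>0 + \<epsilon>) / a n)"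
        using regroup[of "\<bar>\<delta> n\<bar>" "\<epsilon> + (z\<^sub>0 + \<epsilon>) / a n"] by (simp add: abs_mult)
      finally have ratio: "\<bar>?\<Delta> - real n * \<delta> n / z\<^sub>0\<bar> \<le> \<bar>real n * \<delta> n\<bar> * \<bar>\<delta> n\<bar> * K
          + \<bar>real n * \<delta> n\<bar> * K * (\<epsilon> + (z\<^sub>0 + \<epsilon>) / a n)" .
      have "\<bar>real n * \<delta> n / z\<^sub>0 - d / z\<^sub>0\<bar> = \<bar>real n * \<delta> n - d\<bar> / z\<^sub>0"
        using z\<^sub>0_pos by (simp add: abs_divide flip: diff_divide_distrib)
      moreover have "\<bar>?\<Delta> - d / z\<^sub>0\<bar>
        \<le> \<bar>?\<Delta> - real n * \<delta> n / z\<^sub>0\<bar> + \<bar>real n * \<delta> n / z\<^sub>0 - d / z\<^sub>0\<bar>"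
        by (rule triangle)
      ultimately have "\<bar>?\<Delta> - d / z\<^sub>0\<bar> \<le> ?r n"
        using add_left_mono[OF ratio, of "\<bar>real n * \<delta> n - d\<bar> / z\<^sub>0"]
        by argo
      then show "\<bar>?\<Delta> - d / z\<^sub>0\<bar> \<le> \<kappa>"
        using elim(1) by (rule order_trans[OF _ less_imp_le])
    qed
  qed
  then show ?thesis
    using \<epsilon>(1) by blast
qed

end

section \<open>The limit of the ratio\<close>

lemma prob_space_shift:
  fixes g :: "real \<Rightarrow> real"
  assumes g [measurable]: "g \<in> borel_measurable borel"
    and prob: "prob_space (density lborel (\<lambda>x. ennreal (g x)))"
  shows "prob_space (density lborel (\<lambda>x. ennreal (g (x - \<delta>))))"
proof
  have "emeasure (density lborel (\<lambda>x. ennreal (g (x - \<delta>)))) (space (density lborel (\<lambda>x. ennreal (g (x - \<delta>)))))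
    = (\<integral>\<^sup>+x. ennreal (g (x - \<delta>)) \<partial>lborel)"
    by (simp add: emeasure_density)
  also have "\<dots> = (\<integral>\<^sup>+x. ennreal (g x) \<partial>lborel)"
    using nn_integral_real_affine[of "\<lambda>x. ennreal (g x)" 1 "- \<delta>"] by (simp add: add.commute)
  also have "\<dots> = emeasure (density lborel (\<lambda>x. ennreal (g x))) (space (density lborel (\<lambda>x. ennreal (g x))))"
    by (simp add: emeasure_density)
  also have "\<dots> = 1"
    by (rule prob_space.emeasure_space_1[OF prob])
  finally show "emeasure (density lborel (\<lambda>x. ennreal (g (x - \<delta>))))
    (space (density lborel (\<lambda>x. ennreal (g (x - \<delta>))))) = 1" .
qed

context peaked_density
begin

text \<open>
Pick a rate between \<open>\<theta>\<close> and the peak value: the unit volume cancels, and the quotient of the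
masses decays geometrically.
\<close>

lemma far_mass_negligible:
  assumes prob: "prob_space (density lborel (\<lambda>x. ennreal (f x)))"
    and a: "filterlim a at_top sequentially" and \<delta>: "\<delta> \<longlonglongrightarrow> 0" and "\<epsilon> > 0" "\<kappa> > 0"
  shows "\<forall>\<^sub>F n in sequentially.
    measure (iid (\<lambda>x. f (x - \<delta> n)) n) {x \<in> mean_sd_cone n (a n). \<epsilon> < \<bar>mean n x - z\<^sub>0\<bar>}
      \<le> \<kappa> * measure (iid f n) {x \<in> mean_sd_cone n (a n). \<bar>mean n x - z\<^sub>0\<bar> \<le> \<epsilon>}"
proof -
  obtain \<theta> c where \<theta>: "0 < \<theta>" "\<theta> < z\<^sub>0 * f z\<^sub>0" and far: "\<forall>\<^sub>F n in sequentially.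
      emeasure (iid (\<lambda>x. f (x - \<delta> n)) n) {x \<in> mean_sd_cone n (a n). \<epsilon> < \<bar>mean n x - z\<^sub>0\<bar>}
        \<le> ennreal (c * \<theta> ^ n * cone_volume n (a n))"
    using far_mass_le[OF a \<delta> \<open>\<epsilon> > 0\<close>] by blast
  obtain \<rho> where \<rho>: "\<theta> < \<rho>" "\<rho> < z\<^sub>0 * f z\<^sub>0"
    using dense[OF \<theta>(2)] by blast
  have "0 < \<rho>"
    using \<theta>(1) \<rho>(1) by linarith
  obtain b where b: "b > 0" and near: "\<forall>\<^sub>F n in sequentially. ennreal (b * \<rho> ^ n * cone_volume n (a n))
      \<le> emeasure (iid f n) {x \<in> mean_sd_cone n (a n). \<bar>mean n x - z\<^sub>0\<bar> \<le> \<epsilon>}"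
    using near_mass_ge[OF a \<open>\<epsilon> > 0\<close> \<open>0 < \<rho>\<close> \<rho>(2)] by blast
  have "(\<lambda>n. \<bar>c\<bar> * (\<theta> / \<rho>) ^ n) \<longlonglongrightarrow> \<bar>c\<bar> * 0"
    using \<theta>(1) \<rho>(1) by (intro tendsto_mult tendsto_const LIMSEQ_power_zero) auto
  then have "\<forall>\<^sub>F n in sequentially. \<bar>c\<bar> * (\<theta> / \<rho>) ^ n < \<kappa> * b"
    using b \<open>\<kappa> > 0\<close> by (intro order_tendstoD(2)) auto
  moreover have "\<forall>\<^sub>F n in sequentially. a n \<ge> 1"
    using a by (simp add: filterlim_at_top)
  ultimately show ?thesis
    using far near eventually_ge_at_top[of 1]
  proof eventually_elim
    case (elim n)
    let ?F = "{x \<in> mean_sd_cone n (a n). \<epsilon> < \<bar>mean n x - z\<^sub>0\<bar>}"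
    let ?N = "{x \<in> mean_sd_cone n (a n). \<bar>mean n x - z\<^sub>0\<bar> \<le> \<epsilon>}"
    let ?v = "cone_volume n (a n)"
    interpret P: prob_space "iid f n"
      using prob by (intro prob_space_iid) measurable
    interpret Q: prob_space "iid (\<lambda>x. f (x - \<delta> n)) n"
      using prob_space_shift[OF f_measurable prob] by (intro prob_space_iid) measurable
    have v: "?v > 0"
      using elim by (intro cone_volume_pos) auto
    have "ennreal (measure (iid (\<lambda>x. f (x - \<delta> n)) n) ?F) \<le> ennreal (c * \<theta> ^ n * ?v)"
      using elim(3) unfolding Q.emeasure_eq_measure .
    also have "\<dots> \<le> ennreal (\<bar>c\<bar> * \<theta> ^ n * ?v)"
      using v \<theta>(1) by (intro ennreal_leI mult_right_mono) auto
    finally have F: "measure (iid (\<lambda>x. f (x - \<delta> n)) n) ?F \<le> \<bar>c\<bar> * \<theta> ^ n * ?v"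
      using v \<theta>(1) by (subst (asm) ennreal_le_iff) auto
    have "ennreal (b * \<rho> ^ n * ?v) \<le> ennreal (measure (iid f n) ?N)"
      using elim(4) unfolding P.emeasure_eq_measure .
    then have N: "b * \<rho> ^ n * ?v \<le> measure (iid f n) ?N"
      by (subst (asm) ennreal_le_iff) auto
    have "\<bar>c\<bar> * \<theta> ^ n = (\<bar>c\<bar> * (\<theta> / \<rho>) ^ n) * \<rho> ^ n"
      using \<open>0 < \<rho>\<close> by (simp add: power_divide)
    also have "\<dots> \<le> (\<kappa> * b) * \<rho> ^ n"
      using elim(1) \<open>0 < \<rho>\<close> by (intro mult_right_mono) auto
    finally have "\<bar>c\<bar> * \<theta> ^ n * ?v \<le> \<kappa> * b * \<rho> ^ n * ?v"
      using v by (intro mult_right_mono) auto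
    also have "\<dots> \<le> \<kappa> * measure (iid f n) ?N"
      using mult_left_mono[OF N, of \<kappa>] \<open>\<kappa> > 0\<close> by (simp add: mult.assoc)
    finally show ?case
      using F by linarith
  qed
qed

text \<open>
On the near part of the cone the two densities differ by a factor between
\<open>exp (d / z\<^sub>0 - \<kappa>)\<close> and \<open>exp (d / z\<^sub>0 + \<kappa>)\<close>; the far part adds at most \<open>\<kappa>\<close> times the near mass to
either probability.
\<close>

lemma cone_probability_ratio_bounds:
  assumes prob: "prob_space (density lborel (\<lambda>x. ennreal (f x)))"
    and a: "filterlim a at_top sequentially" and d: "(\<lambda>n. real n * \<delta> n) \<longlonglongrightarrow> d"
    and \<kappa>: "\<kappa> > 0"
  shows "\<forall>\<^sub>F n in sequentially.
    exp (d / z\<^sub>0 - \<kappa>) / (1 + \<kappa>) \<le> measure (iid (\<lambda>x. f (x - \<delta> n)) n) (mean_sd_cone n (a n))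
        / measure (iid f n) (mean_sd_cone n (a n)) \<and>
    measure (iid (\<lambda>x. f (x - \<delta> n)) n) (mean_sd_cone n (a n))
        / measure (iid f n) (mean_sd_cone n (a n)) \<le> exp (d / z\<^sub>0 + \<kappa>) + \<kappa>"
proof -
  have "(\<lambda>n. (real n * \<delta> n) * (1 / real n)) \<longlonglongrightarrow> d * 0"
    by (intro tendsto_mult d lim_1_over_n)
  then have "(\<lambda>n. real n * \<delta> n * (1 / real n)) \<longlonglongrightarrow> 0"
    by simp
  then have \<delta>: "\<delta> \<longlonglongrightarrow> 0"
  proof (rule Lim_transform_eventually)
    show "\<forall>\<^sub>F n in sequentially. real n * \<delta> n * (1 / real n) = \<delta> n"
      using eventually_gt_at_top[of 0] by eventually_elim simp
  qed
  obtain \<epsilon> where \<epsilon>: "\<epsilon> > 0" and ratio: "\<forall>\<^sub>F n in sequentially.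
      \<forall>x\<in>mean_sd_cone n (a n). \<bar>mean n x - z\<^sub>0\<bar> \<le> \<epsilon> \<longrightarrow>
        \<bar>(\<Sum>i=1..n. h (x i - \<delta> n)) - (\<Sum>i=1..n. h (x i)) - d / z\<^sub>0\<bar> \<le> \<kappa>"
    using near_likelihood_ratio[OF a d \<delta> \<kappa>] by blast
  obtain b where b: "b > 0" and near: "\<forall>\<^sub>F n in sequentially.
      ennreal (b * (z\<^sub>0 * f z\<^sub>0 / 2) ^ n * cone_volume n (a n))
        \<le> emeasure (iid f n) {x \<in> mean_sd_cone n (a n). \<bar>mean n x - z\<^sub>0\<bar> \<le> \<epsilon>}"
    using near_mass_ge[OF a \<epsilon>, of "z\<^sub>0 * f z\<^sub>0 / 2"] peak_value_pos by auto
  have "\<forall>\<^sub>F n in sequentially. a n \<ge> 1"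
    using a by (simp add: filterlim_at_top)
  then show ?thesis
    using ratio near far_mass_negligible[OF prob a tendsto_const[of 0] \<epsilon> \<kappa>]
      far_mass_negligible[OF prob a \<delta> \<epsilon> \<kappa>] eventually_ge_at_top[of 1]
  proof eventually_elim
    case (elim n)
    let ?C = "mean_sd_cone n (a n)" and ?P = "measure (iid f n)"
      and ?Q = "measure (iid (\<lambda>x. f (x - \<delta> n)) n)"
    let ?F = "{x \<in> ?C. \<epsilon> < \<bar>mean n x - z\<^sub>0\<bar>}" and ?N = "{x \<in> ?C. \<bar>mean n x - z\<^sub>0\<bar> \<le> \<epsilon>}"
    interpret P: prob_space "iid f n"
      using prob by (intro prob_space_iid) measurable
    interpret Q: prob_space "iid (\<lambda>x. f (x - \<delta> n)) n"
      using prob_space_shift[OF f_measurable prob] by (intro prob_space_iid) measurable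
    have F: "?F \<in> sets (Leb n)"
      using cone_slab_sets[of "{z. \<epsilon> < \<bar>z - z\<^sub>0\<bar>}" n "a n"] by simp
    have N: "?N \<in> sets (Leb n)"
      using cone_slab_sets[of "{z. \<bar>z - z\<^sub>0\<bar> \<le> \<epsilon>}" n "a n"] by simp
    have split: "?C = ?N \<union> ?F" by auto
    have PC: "?P ?N \<le> ?P ?C" "?P ?C \<le> ?P ?N + ?P ?F"
      using cone_sets[of n "a n"] measure_Un_le[of ?N "iid f n" ?F] F N
      by (auto intro!: P.finite_measure_mono simp flip: split)
    have QC: "?Q ?N \<le> ?Q ?C" "?Q ?C \<le> ?Q ?N + ?Q ?F"
      using cone_sets[of n "a n"] measure_Un_le[of ?N "iid (\<lambda>x. f (x - \<delta> n)) n" ?F] F N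
      by (auto intro!: Q.finite_measure_mono simp flip: split)
    have PF: "?P ?F \<le> \<kappa> * ?P ?N" and QF: "?Q ?F \<le> \<kappa> * ?P ?N"
      using elim(4,5) by simp_all
    have "cone_volume n (a n) > 0"
      using elim by (intro cone_volume_pos) auto
    then have "0 < b * (z\<^sub>0 * f z\<^sub>0 / 2) ^ n * cone_volume n (a n)"
      using b peak_value_pos by simp
    moreover have "b * (z\<^sub>0 * f z\<^sub>0 / 2) ^ n * cone_volume n (a n) \<le> ?P ?N"
      using elim(3) unfolding P.emeasure_eq_measure by (subst (asm) ennreal_le_iff) auto
    ultimately have PN: "0 < ?P ?N" by linarith
    have llr: "(\<Sum>i=1..n. h (x i - \<delta> n)) \<le> d / z\<^sub>0 + \<kappa> + (\<Sum>i=1..n. h (x i))"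
      "(\<Sum>i=1..n. h (x i)) \<le> - (d / z\<^sub>0 - \<kappa>) + (\<Sum>i=1..n. h (x i - \<delta> n))" if "x \<in> ?N" for x
      using elim(2)[rule_format, of x] that unfolding abs_le_iff mem_Collect_eq by linarith+
    have "emeasure (iid (\<lambda>x. f (x - \<delta> n)) n) ?N \<le> ennreal (exp (d / z\<^sub>0 + \<kappa>)) * emeasure (iid f n) ?N"
    proof (rule emeasure_iid_mono[OF _ _ _ _ _ N])
      show "(\<Prod>i=1..n. f (x i - \<delta> n)) \<le> exp (d / z\<^sub>0 + \<kappa>) * (\<Prod>i=1..n. f (x i))" if "x \<in> ?N" for x
        unfolding prod_f exp_add[symmetric] exp_le_cancel_iff by (rule llr(1)[OF that])
    qed (use f_pos in \<open>auto simp: less_imp_le\<close>)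
    then have QN: "?Q ?N \<le> exp (d / z\<^sub>0 + \<kappa>) * ?P ?N"
      unfolding P.emeasure_eq_measure Q.emeasure_eq_measure
      by (simp add: ennreal_le_iff flip: ennreal_mult)
    have "emeasure (iid f n) ?N
      \<le> ennreal (exp (- (d / z\<^sub>0 - \<kappa>))) * emeasure (iid (\<lambda>x. f (x - \<delta> n)) n) ?N"
    proof (rule emeasure_iid_mono[OF _ _ _ _ _ N])
      show "(\<Prod>i=1..n. f (x i)) \<le> exp (- (d / z\<^sub>0 - \<kappa>)) * (\<Prod>i=1..n. f (x i - \<delta> n))" if "x \<in> ?N" for x
        unfolding prod_f exp_add[symmetric] exp_le_cancel_iff by (rule llr(2)[OF that])
    qed (use f_pos in \<open>auto simp: less_imp_le\<close>)
    then have "?P ?N \<le> exp (- (d / z\<^sub>0 - \<kappa>)) * ?Q ?N"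
      unfolding P.emeasure_eq_measure Q.emeasure_eq_measure
      by (simp add: ennreal_le_iff flip: ennreal_mult)
    then have "exp (d / z\<^sub>0 - \<kappa>) * ?P ?N
      \<le> exp (d / z\<^sub>0 - \<kappa>) * (exp (- (d / z\<^sub>0 - \<kappa>)) * ?Q ?N)"
      by (intro mult_left_mono) auto
    also have "\<dots> = ?Q ?N"
      unfolding mult.assoc[symmetric] exp_add[symmetric] by simp
    finally have NQ: "exp (d / z\<^sub>0 - \<kappa>) * ?P ?N \<le> ?Q ?N" .
    have "exp (d / z\<^sub>0 - \<kappa>) / (1 + \<kappa>) * ?P ?C \<le> exp (d / z\<^sub>0 - \<kappa>) / (1 + \<kappa>) * ((1 + \<kappa>) * ?P ?N)"
      using PC(2) PF \<kappa> by (intro mult_left_mono) (auto simp: distrib_right)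
    also have "\<dots> = exp (d / z\<^sub>0 - \<kappa>) * ?P ?N"
      using \<kappa> by simp
    finally have lower: "exp (d / z\<^sub>0 - \<kappa>) / (1 + \<kappa>) * ?P ?C \<le> ?Q ?C"
      using NQ QC(1) by linarith
    have "?Q ?C \<le> (exp (d / z\<^sub>0 + \<kappa>) + \<kappa>) * ?P ?N"
      using QC(2) QN QF by (simp add: distrib_right)
    also have "\<dots> \<le> (exp (d / z\<^sub>0 + \<kappa>) + \<kappa>) * ?P ?C"
      using PC(1) \<kappa> by (intro mult_left_mono add_nonneg_nonneg) auto
    finally have upper: "?Q ?C \<le> (exp (d / z\<^sub>0 + \<kappa>) + \<kappa>) * ?P ?C" .
    have "?P ?C > 0"
      using PN PC(1) by linarith
    then show ?case
      using lower upper by (simp only: pos_le_divide_eq pos_divide_le_eq)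
  qed
qed

lemma cone_probability_ratio_limit:
  assumes prob: "prob_space (density lborel (\<lambda>x. ennreal (f x)))"
    and a: "filterlim a at_top sequentially" and d: "(\<lambda>n. real n * \<delta> n) \<longlonglongrightarrow> d"
  shows "(\<lambda>n. measure (iid (\<lambda>x. f (x - \<delta> n)) n) (mean_sd_cone n (a n))
    / measure (iid f n) (mean_sd_cone n (a n))) \<longlonglongrightarrow> exp (d / z\<^sub>0)"
    (is "?r \<longlonglongrightarrow> _")
proof (rule order_tendstoI)
  fix u assume u: "u < exp (d / z\<^sub>0)"
  have "((\<lambda>\<kappa>. exp (d / z\<^sub>0 - \<kappa>) / (1 + \<kappa>)) \<longlongrightarrow> exp (d / z\<^sub>0 - 0) / (1 + 0)) (at_right 0)"
    by (intro tendsto_intros) auto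
  then have "\<forall>\<^sub>F \<kappa> in at_right 0. u < exp (d / z\<^sub>0 - \<kappa>) / (1 + \<kappa>)"
    using u by (intro order_tendstoD(1)) auto
  then have "\<forall>\<^sub>F \<kappa> in at_right 0. u < exp (d / z\<^sub>0 - \<kappa>) / (1 + \<kappa>) \<and> 0 < \<kappa>"
    using eventually_at_right_less[of 0] by eventually_elim auto
  then obtain \<kappa> where \<kappa>: "u < exp (d / z\<^sub>0 - \<kappa>) / (1 + \<kappa>)" "0 < \<kappa>"
    using eventually_happens'[OF trivial_limit_at_right_real] by blast
  show "\<forall>\<^sub>F n in sequentially. u < ?r n"
    using cone_probability_ratio_bounds[OF prob a d \<kappa>(2)]
    by eventually_elim (use \<kappa>(1) in linarith)
next
  fix u assume u: "exp (d / z\<^sub>0) < u"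
  have "((\<lambda>\<kappa>. exp (d / z\<^sub>0 + \<kappa>) + \<kappa>) \<longlongrightarrow> exp (d / z\<^sub>0 + 0) + 0) (at_right 0)"
    by (intro tendsto_intros)
  then have "\<forall>\<^sub>F \<kappa> in at_right 0. exp (d / z\<^sub>0 + \<kappa>) + \<kappa> < u"
    using u by (intro order_tendstoD(2)) auto
  then have "\<forall>\<^sub>F \<kappa> in at_right 0. exp (d / z\<^sub>0 + \<kappa>) + \<kappa> < u \<and> 0 < \<kappa>"
    using eventually_at_right_less[of 0] by eventually_elim auto
  then obtain \<kappa> where \<kappa>: "exp (d / z\<^sub>0 + \<kappa>) + \<kappa> < u" "0 < \<kappa>"
    using eventually_happens'[OF trivial_limit_at_right_real] by blast
  show "\<forall>\<^sub>F n in sequentially. ?r n < u"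
    using cone_probability_ratio_bounds[OF prob a d \<kappa>(2)]
    by eventually_elim (use \<kappa>(1) in linarith)
qed

end

section \<open>Observations with a smooth heavy-tailed density\<close>

lemma heavy_tail_bound_of_Limsup:
  fixes f :: "real \<Rightarrow> real"
  assumes "Limsup at_top (\<lambda>x. ereal (x powr (1 + \<gamma>) * f x)) < \<infinity>"
  shows "\<exists>C x\<^sub>0. x\<^sub>0 > 0 \<and> (\<forall>x\<ge>x\<^sub>0. f x \<le> C * x powr (- (1 + \<gamma>)))"
proof -
  obtain C where "Limsup at_top (\<lambda>x. ereal (x powr (1 + \<gamma>) * f x)) < ereal C"
    using assms ereal_dense2 by blast
  then have "\<forall>\<^sub>F x in at_top. ereal (x powr (1 + \<gamma>) * f x) < ereal C"
    by (rule Limsup_lessD)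
  then obtain x\<^sub>1 where x\<^sub>1: "\<And>x. x \<ge> x\<^sub>1 \<Longrightarrow> x powr (1 + \<gamma>) * f x < C"
    by (auto simp: eventually_at_top_linorder)
  show ?thesis
  proof (rule exI[of _ C], rule exI[of _ "max x\<^sub>1 1"], intro conjI allI impI)
    fix x assume "x \<ge> max x\<^sub>1 1"
    then have "x powr (1 + \<gamma>) * f x < C" "x > 0"
      using x\<^sub>1 by auto
    then have "f x < C / x powr (1 + \<gamma>)"
      by (simp add: pos_less_divide_eq mult.commute)
    then show "f x \<le> C * x powr (- (1 + \<gamma>))"
      unfolding powr_minus_divide by simp
  qed simp
qed

lemma lipschitz_of_bounded_deriv:
  fixes g :: "real \<Rightarrow> real"
  assumes "g differentiable_on UNIV" and "\<And>x. \<bar>deriv g x\<bar> \<le> K"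
  shows "\<bar>g x - g y\<bar> \<le> K * \<bar>x - y\<bar>"
proof -
  have "(g has_field_derivative deriv g z) (at z within UNIV)" for z
    using assms(1) by (simp add: differentiable_on_def DERIV_deriv_iff_real_differentiable)
  then show ?thesis
    using field_differentiable_bound[of UNIV g "deriv g" K x y] assms(2) by simp
qed

theorem theorem1p1:
  fixes M :: "'a measure"
    and X :: "nat \<Rightarrow> 'a \<Rightarrow> real"
    and f h :: "real \<Rightarrow> real"
    and \<gamma> z\<^sub>0 d :: real
    and a ds :: "nat \<Rightarrow> real"
  assumes "prob_space M"
    and "prob_space.indep_vars M (\<lambda>_. borel) X {1..}"
    and "\<And>i. i \<ge> 1 \<Longrightarrow> distributed M lborel (X i) (\<lambda>x. ennreal (f x))"
    and "\<P>(\<omega> in M. X 1 \<omega> > 0) > 0"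
    and "bounded (range f)"
    and "continuous_on UNIV f"
    and "\<gamma> > 0"
    and "Limsup at_top (\<lambda>x. ereal (x powr (1 + \<gamma>) * f x)) < \<infinity>"
    and "is_arg_max (\<lambda>z. z * f z) (\<lambda>_. True) z\<^sub>0"
    and "\<And>z. is_arg_max (\<lambda>z. z * f z) (\<lambda>_. True) z \<Longrightarrow> z = z\<^sub>0"
    and "z\<^sub>0 > 0"
    and "\<And>x. f x > 0"
    and "h = (\<lambda>x. ln (f x))"
    and "h differentiable_on UNIV"
    and "deriv h differentiable_on UNIV"
    and "deriv (deriv h) differentiable_on UNIV"
    and "bdd_above (range (\<lambda>x. \<bar>deriv (deriv h) x\<bar>))"
    and "bdd_above (range (\<lambda>x. \<bar>deriv (deriv (deriv h)) x\<bar>))"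
    and "filterlim a at_top sequentially"
    and "(\<lambda>n. a n ^ 4) \<in> o(\<lambda>n. real n / ln (real n))"
    and "ds \<longlonglongrightarrow> d"
    and "d > 0"
  shows "(\<lambda>n. \<P>(\<omega> in M. sample_mean X n \<omega> + ds n / real n \<ge> a n * sample_sd X n \<omega>)
            / \<P>(\<omega> in M. sample_mean X n \<omega> \<ge> a n * sample_sd X n \<omega>))
         \<longlonglongrightarrow> exp (d / z\<^sub>0)"
proof -
  note ind = assms(2) and dist = assms(3)
  interpret prob_space M by (rule assms(1))
  obtain B where B: "\<And>x. \<bar>f x\<bar> \<le> B"
    using assms(5) by (auto simp: bounded_iff)
  obtain K where K: "\<And>x. \<bar>deriv (deriv h) x\<bar> \<le> K"
    using assms(17) by (auto simp: bdd_above_def)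
  obtain C x\<^sub>0 where C: "x\<^sub>0 > 0" "\<And>x. x \<ge> x\<^sub>0 \<Longrightarrow> f x \<le> C * x powr (- (1 + \<gamma>))"
    using heavy_tail_bound_of_Limsup[OF assms(8)] by blast
  interpret peaked_density f h "deriv h" K B \<gamma> C x\<^sub>0 z\<^sub>0
  proof
    show "f x = exp (h x)" for x
      using assms(12)[of x] by (simp add: assms(13))
    show "(h has_real_derivative deriv h x) (at x)" for x
      using assms(14) by (simp add: differentiable_on_def DERIV_deriv_iff_real_differentiable)
    show "\<bar>deriv h x - deriv h y\<bar> \<le> K * \<bar>x - y\<bar>" for x y
      by (rule lipschitz_of_bounded_deriv[OF assms(15) K])
    show "f x \<le> B" for x
      using B[of x] by linarith
    show "z * f z < z\<^sub>0 * f z\<^sub>0" if "z \<noteq> z\<^sub>0" for z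
    proof (rule ccontr)
      assume "\<not> z * f z < z\<^sub>0 * f z\<^sub>0"
      then have "is_arg_max (\<lambda>z. z * f z) (\<lambda>_. True) z"
        using assms(9) unfolding is_arg_max_linorder not_less by (blast intro: order_trans)
      then show False
        using assms(10) that by blast
    qed
  qed (use assms(7,11) C in auto)
  have rv: "random_variable lborel (X 1)"
    using distributed_measurable[OF dist[of 1]] by simp
  have "density lborel (\<lambda>x. ennreal (f x)) = distr M lborel (X 1)"
    using distributed_distr_eq_density[OF dist[of 1]] by simp
  then have prob: "prob_space (density lborel (\<lambda>x. ennreal (f x)))"
    using prob_space_distr[OF rv] by simp
  have "(\<lambda>n. real n * (ds n / real n)) \<longlonglongrightarrow> d"
  proof (rule Lim_transform_eventually[OF assms(21)])
    show "\<forall>\<^sub>F n in sequentially. ds n = real n * (ds n / real n)"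
      using eventually_gt_at_top[of 0] by eventually_elim simp
  qed
  then have "(\<lambda>n. measure (iid (\<lambda>x. f (x - ds n / real n)) n) (mean_sd_cone n (a n))
      / measure (iid f n) (mean_sd_cone n (a n))) \<longlonglongrightarrow> exp (d / z\<^sub>0)"
    by (rule cone_probability_ratio_limit[OF prob assms(19)])
  then show ?thesis
  proof (rule Lim_transform_eventually)
    show "\<forall>\<^sub>F n in sequentially.
      measure (iid (\<lambda>x. f (x - ds n / real n)) n) (mean_sd_cone n (a n))
        / measure (iid f n) (mean_sd_cone n (a n))
      = \<P>(\<omega> in M. sample_mean X n \<omega> + ds n / real n \<ge> a n * sample_sd X n \<omega>)
        / \<P>(\<omega> in M. sample_mean X n \<omega> \<ge> a n * sample_sd X n \<omega>)"
      using eventually_ge_at_top[of 1]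
    proof eventually_elim
      case (elim n)
      show ?case
        using prob_shifted_eq_cone[OF ind dist f_measurable elim, of "a n" "ds n / real n"]
          prob_shifted_eq_cone[OF ind dist f_measurable elim, of "a n" 0] by simp
    qed
  qed
qed

end
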